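(* With respect to $(\varphi_1,\varphi_2,\varphi_3,\varphi_4)$, the connection $\nabla_X$ is represented as $$\nabla_X\,{}^t(\varphi_1,\dots,\varphi_4)=\Xi\wedge{}^t(\varphi_1,\dots,\varphi_4)$$ (an identity of classes in $\Omega^{2,1}(\mathfrak X)/\nabla(\Omega^{1,1}(\mathfrak X))$), where $\Xi=\Xi^1dx_1+\Xi^2dx_2$ and $$\Xi^1=\begin{pmatrix} 0&-\frac{\lambda_4}{x_1}&0&0\\ 0&-\frac{\lambda_1+\lambda_3}{x_1}&0&-\lambda_3\\ -\frac{\lambda_1+\lambda_2+\lambda_3}{2x_1}&-\frac{\lambda_2-\lambda_4}{2x_1}&-\frac{\lambda_1-\lambda_4}{2x_1}&-\frac{\lambda_3(1-x_1-x_2)}{2x_1}\\ \Xi^1_{4,1}&\Xi^1_{4,2}&\Xi^1_{4,3}&\Xi^1_{4,4} \end{pmatrix},$$ $$\Xi^2=\begin{pmatrix} 0&0&-\frac{\lambda_4}{x_2}&0\\ -\frac{\lambda_1+\lambda_2+\lambda_3}{2x_2}&-\frac{\lambda_2-\lambda_4}{2x_2}&-\frac{\lambda_1-\lambda_4}{2x_2}&-\frac{\lambda_3(1-x_1-x_2)}{2x_2}\\ 0&0&-\frac{\lambda_2+\lambda_3}{x_2}&-\lambda_3\\ \Xi^2_{4,1}&\Xi^2_{4,2}&\Xi^2_{4,3}&\Xi^2_{4,4} \end{pmatrix},$$ with $$\Xi^1_{4,1}=\frac{\lambda_1+\lambda_2+\lambda_3}{\lambda_3}\left(\frac{\lambda_1-\lambda_2}{R(x)}-\frac{(\lambda_1+2\lambda_3+\lambda_4)(1+x_1-x_2)}{2x_1R(x)}\right),$$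 $$\Xi^1_{4,2}=-\frac{(\lambda_2-\lambda_4)(\lambda_2+2\lambda_3+\lambda_4)}{\lambda_3R(x)}+\frac{\lambda_1\lambda_2+\lambda_1\lambda_4+\lambda_2\lambda_4+2\lambda_3\lambda_4+\lambda_4^2}{2\lambda_3}\cdot\frac{1-x_1-x_2}{x_1R(x)},$$ $$\Xi^1_{4,3}=\frac{\lambda_1\lambda_2+\lambda_1\lambda_4+\lambda_2\lambda_4+2\lambda_3\lambda_4+\lambda_4^2}{\lambda_3R(x)}-\frac{(\lambda_1-\lambda_4)(\lambda_1+\lambda_4+2\lambda_3)}{2\lambda_3}\cdot\frac{1-x_1-x_2}{x_1R(x)},$$ $$\Xi^1_{4,4}=-(\lambda_1-2\lambda_3-3\lambda_4+2)\frac{x_1}{2R(x)}+(\lambda_1-\lambda_4+1)\frac{1+x_2}{R(x)}-(\lambda_1+2\lambda_3+\lambda_4)\frac{(x_2-1)^2}{2x_1R(x)},$$ $$\Xi^2_{4,1}=\frac{\lambda_1+\lambda_2+\lambda_3}{\lambda_3}\left(\frac{\lambda_2-\lambda_1}{R(x)}-\frac{(\lambda_2+2\lambda_3+\lambda_4)(1-x_1+x_2)}{2x_2R(x)}\right),$$ $$\Xi^2_{4,2}=\frac{\lambda_1\lambda_2+\lambda_1\lambda_4+\lambda_2\lambda_4+2\lambda_3\lambda_4+\lambda_4^2}{\lambda_3R(x)}-\frac{(\lambda_2-\lambda_4)(\lambda_2+2\lambda_3+\lambda_4)}{2\lambda_3}\cdot\frac{1-x_1-x_2}{x_2R(x)},$$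 $$\Xi^2_{4,3}=-\frac{(\lambda_1-\lambda_4)(\lambda_1+\lambda_4+2\lambda_3)}{\lambda_3R(x)}+\frac{\lambda_1\lambda_2+\lambda_1\lambda_4+\lambda_2\lambda_4+2\lambda_3\lambda_4+\lambda_4^2}{2\lambda_3}\cdot\frac{1-x_1-x_2}{x_2R(x)},$$ $$\Xi^2_{4,4}=-(\lambda_2-2\lambda_3-3\lambda_4+2)\frac{x_2}{2R(x)}+(\lambda_2-\lambda_4+1)\frac{x_1+1}{R(x)}-(\lambda_2+2\lambda_3+\lambda_4)\frac{(x_1-1)^2}{2x_2R(x)}.$$
   Context: The parameters $a,b,c_1,c_2$ are indeterminates, $\lambda_1=a-c_2+1$, $\lambda_2=a-c_1+1$, $\lambda_3=c_1+c_2-a-2$, $\lambda_4=-b$, and all vector spaces are over $\mathbb C(\lambda)=\mathbb C(\lambda_1,\dots,\lambda_4)$. (When complex values are assigned to the parameters, it is assumed that none of $a$, $a-c_1+1$, $a-c_2+1$, $a-c_1-c_2+2$, $b$, $b-c_1+1$, $b-c_2+1$, $b-c_1-c_2+2$ is an integer.) Put $R(x)=x_1^2+x_2^2-2x_1x_2-2x_1-2x_2+1$, $S=\{(x_1,x_2)\in\mathbb C^2\mid x_1x_2R(x)=0\}\cup L_\infty\subset\mathbb P^2$ ($L_\infty$ the line at infinity), $X=\mathbb P^2\setminus S$. Put $Q=Q(s)=s_1s_2-s_1-s_2$, $L=L(s,x)=1-s_1x_1-s_2x_2$, and $\mathfrak X=\{(s,x)\in\mathbb C^2\times X\mid s_1s_2Q(s)L(s,x)\neq0\}\subset(\mathbb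 P^1\times\mathbb P^1)\times\mathbb P^2$. Let $\Omega^{i,j}(\mathfrak X)$ be the space of rational $(i+j)$-forms on $(\mathbb P^1\times\mathbb P^1)\times\mathbb P^2$, with poles only along the complement of $\mathfrak X$, that are of degree $i$ in $ds_1,ds_2$ and degree $j$ in $dx_1,dx_2$. Let $d_s,d_x$ be the exterior derivatives in $s_1,s_2$ and in $x_1,x_2$, and set $$\omega=\frac{\lambda_1ds_1}{s_1}+\frac{\lambda_2ds_2}{s_2}+\frac{\lambda_3d_sQ}{Q}+\frac{\lambda_4d_sL}{L},\qquad \omega_X=-\frac{\lambda_4s_1dx_1}{L}-\frac{\lambda_4s_2dx_2}{L},$$ $\nabla=d_s+\omega\wedge$, $\nabla_X=d_x+\omega_X\wedge$. Put $H^2(\Omega^{\bullet,0}(\mathfrak X),\nabla)=\Omega^{2,0}(\mathfrak X)/\nabla(\Omega^{1,0}(\mathfrak X))$. The connection $\nabla_X$ induces a map $H^2(\Omega^{\bullet,0}(\mathfrak X),\nabla)\to\Omega^{2,1}(\mathfrak X)/\nabla(\Omega^{1,1}(\mathfrak X))$. With $ds_{12}=ds_1\wedge ds_2$, the elements $\varphi_i\in H^2(\Omega^{\bullet,0}(\mathfrak X),\nabla)$ are the classes of $$\varphi_1=\frac{ds_{12}}{s_1s_2},\quad\varphi_2=\frac{x_1ds_{12}}{s_2L},\quad\varphi_3=\frac{x_2ds_{12}}{s_1L},\quad\varphi_4=\frac{ds_{12}}{QL}.$$ *)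

theory Defs
  imports
    "HOL-Computational_Algebra.Computational_Algebra"
    "HOL-Library.Function_Algebras"
    "HOL-Library.Set_Algebras"
begin

section \<open>Rational functions in \<open>s\<^sub>1, s\<^sub>2, x\<^sub>1, x\<^sub>2\<close> over \<open>\<complex>(a, b, c\<^sub>1, c\<^sub>2)\<close>\<close>

text \<open>
  The field of the parameters is the rational function field in four indeterminates
  \<open>a, b, c\<^sub>1, c\<^sub>2\<close>; since the \<open>\<lambda>\<^sub>i\<close> below are an affine change of these
  indeterminates, it is \<open>\<complex>(\<lambda>\<^sub>1, \<dots>, \<lambda>\<^sub>4)\<close>.
\<close>

type_synonym param_field = "complex poly poly poly poly fract"

definition par_a :: param_field where "par_a = to_fract [:0, 1:]"
definition par_b :: param_field where "par_b = to_fract [:[:0, 1:]:]"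
definition par_c1 :: param_field where "par_c1 = to_fract [:[:[:0, 1:]:]:]"
definition par_c2 :: param_field where "par_c2 = to_fract [:[:[:[:0, 1:]:]:]:]"

text \<open>
  Polynomials in the coordinates are iterated univariate polynomials, with
  \<open>s\<^sub>1\<close> the outermost and \<open>x\<^sub>2\<close> the innermost variable.
\<close>

type_synonym coord_poly = "param_field poly poly poly poly"
type_synonym ratfun = "coord_poly fract"

datatype coord = S1 | S2 | X1 | X2

definition const :: "param_field \<Rightarrow> ratfun" where
  "const c = to_fract [:[:[:[:c:]:]:]:]"

definition s1 :: ratfun where "s1 = to_fract [:0, 1:]"
definition s2 :: ratfun where "s2 = to_fract [:[:0, 1:]:]"
definition x1 :: ratfun where "x1 = to_fract [:[:[:0, 1:]:]:]"
definition x2 :: ratfun where "x2 = to_fract [:[:[:[:0, 1:]:]:]:]"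

fun poly_partial :: "coord \<Rightarrow> coord_poly \<Rightarrow> coord_poly" where
  "poly_partial S1 = pderiv"
| "poly_partial S2 = map_poly pderiv"
| "poly_partial X1 = map_poly (map_poly pderiv)"
| "poly_partial X2 = map_poly (map_poly (map_poly pderiv))"

definition is_derivation :: "('a::comm_ring_1 \<Rightarrow> 'a) \<Rightarrow> bool" where
  "is_derivation D \<longleftrightarrow>
     (\<forall>p q. D (p + q) = D p + D q) \<and> (\<forall>p q. D (p * q) = D p * q + p * D q)"

lemma is_derivation_pderiv: "is_derivation (pderiv :: 'a::idom poly \<Rightarrow> 'a poly)"
  by (simp add: is_derivation_def pderiv_add pderiv_mult algebra_simps)

lemma is_derivation_map_poly:
  assumes "is_derivation D"
  shows "is_derivation (map_poly D)"
proof -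
  have add: "D (p + q) = D p + D q" and mult: "D (p * q) = D p * q + p * D q" for p q
    using assms by (auto simp: is_derivation_def)
  have [simp]: "D 0 = 0"
    using add[of 0 0] by simp
  have sum: "D (\<Sum>i\<in>A. f i) = (\<Sum>i\<in>A. D (f i))" for A :: "nat set" and f
    by (induction A rule: infinite_finite_induct) (simp_all add: add)
  show ?thesis
    unfolding is_derivation_def
    by (auto simp: poly_eq_iff coeff_map_poly coeff_mult add mult sum sum.distrib)
qed

lemma is_derivation_poly_partial: "is_derivation (poly_partial i)"
  by (cases i) (simp_all add: is_derivation_pderiv is_derivation_map_poly)

text \<open>The partial derivatives of rational functions, by the quotient rule.\<close>

definition partial :: "coord \<Rightarrow> ratfun \<Rightarrow> ratfun" where
  "partial i f = (THE g. \<exists>p q. q \<noteq> 0 \<and> f = Fract p q \<and>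
     g = Fract (poly_partial i p * q - p * poly_partial i q) (q ^ 2))"

lemma partial_Fract:
  assumes "q \<noteq> 0"
  shows "partial i (Fract p q) = Fract (poly_partial i p * q - p * poly_partial i q) (q ^ 2)"
  unfolding partial_def
proof (rule the_equality)
  let ?D = "poly_partial i"
  fix g
  assume "\<exists>p' q'. q' \<noteq> 0 \<and> Fract p q = Fract p' q' \<and>
    g = Fract (?D p' * q' - p' * ?D q') (q' ^ 2)"
  then obtain p' q' where nz: "q' \<noteq> 0" and eq': "Fract p q = Fract p' q'"
    and g: "g = Fract (?D p' * q' - p' * ?D q') (q' ^ 2)"
    by blast
  have eq: "p * q' = p' * q"
    using eq' nz assms by (simp add: eq_fract)
  have mult: "?D (u * v) = ?D u * v + u * ?D v" for u v
    using is_derivation_poly_partial[of i] by (simp add: is_derivation_def)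
  have "?D p * q' + p * ?D q' = ?D p' * q + p' * ?D q"
    using arg_cong[OF eq, of ?D] by (simp only: mult)
  with eq have "(?D p * q - p * ?D q) * q'\<^sup>2 = (?D p' * q' - p' * ?D q') * q\<^sup>2"
    by algebra
  then show "g = Fract (?D p * q - p * ?D q) (q ^ 2)"
    using nz assms by (simp add: g eq_fract)
qed (use assms in blast)

definition lam1 :: ratfun where "lam1 = const (par_a - par_c2 + 1)"
definition lam2 :: ratfun where "lam2 = const (par_a - par_c1 + 1)"
definition lam3 :: ratfun where "lam3 = const (par_c1 + par_c2 - par_a - 2)"
definition lam4 :: ratfun where "lam4 = const (- par_b)"

definition RR :: ratfun where "RR = x1^2 + x2^2 - 2*x1*x2 - 2*x1 - 2*x2 + 1"
definition QQ :: ratfun where "QQ = s1*s2 - s1 - s2"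
definition LL :: ratfun where "LL = 1 - s1*x1 - s2*x2"

text \<open>
  The rational functions whose poles lie in the complement of \<open>\<XX>\<close>. That complement contains
  the divisors \<open>s\<^sub>1 = \<infinity>\<close>, \<open>s\<^sub>2 = \<infinity>\<close> and \<open>L\<^sub>\<infinity>\<close>, so there is no bound on the order at
  infinity, and the condition is that a power of the equation of the finite part of the
  complement clears the denominator.
\<close>

definition regular_funs :: "ratfun set" where
  "regular_funs = {f. \<exists>n p. f * (s1 * s2 * QQ * LL * x1 * x2 * RR) ^ n = to_fract p}"


section \<open>Differential forms\<close>

text \<open>
  A form is the family of its coefficients: \<open>\<alpha> I\<close> is the coefficient of the wedge product of
  the \<open>dz\<close>, \<open>z \<in> I\<close>, taken in the order \<open>s\<^sub>1, s\<^sub>2, x\<^sub>1, x\<^sub>2\<close>. Addition is pointwise;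
  the pointwise product of functions is not used.
\<close>

type_synonym form = "coord set \<Rightarrow> ratfun"

fun position :: "coord \<Rightarrow> nat" where
  "position S1 = 0" | "position S2 = 1" | "position X1 = 2" | "position X2 = 3"

definition shuffle_sign :: "coord set \<Rightarrow> coord set \<Rightarrow> ratfun" where
  "shuffle_sign J K = (- 1) ^ card {(j, k). j \<in> J \<and> k \<in> K \<and> position k < position j}"

definition wedge :: "form \<Rightarrow> form \<Rightarrow> form"  (infixr "\<and>\<^sub>f" 70) where
  "\<alpha> \<and>\<^sub>f \<beta> = (\<lambda>I. \<Sum>J\<in>Pow I. shuffle_sign J (I - J) * \<alpha> J * \<beta> (I - J))"

definition scale :: "ratfun \<Rightarrow> form \<Rightarrow> form"  (infixr "*\<^sub>f" 75) where
  "f *\<^sub>f \<alpha> = (\<lambda>I. f * \<alpha> I)"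

definition zero_form :: "ratfun \<Rightarrow> form" where
  "zero_form f = (\<lambda>I. if I = {} then f else 0)"

definition dcoord :: "coord \<Rightarrow> form" where
  "dcoord i = (\<lambda>I. if I = {i} then 1 else 0)"

abbreviation "ds1 \<equiv> dcoord S1"
abbreviation "ds2 \<equiv> dcoord S2"
abbreviation "dx1 \<equiv> dcoord X1"
abbreviation "dx2 \<equiv> dcoord X2"
abbreviation "ds12 \<equiv> ds1 \<and>\<^sub>f ds2"

definition d_s :: "form \<Rightarrow> form" where
  "d_s \<alpha> = (\<Sum>i\<in>{S1, S2}. dcoord i \<and>\<^sub>f (\<lambda>I. partial i (\<alpha> I)))"

definition d_x :: "form \<Rightarrow> form" where
  "d_x \<alpha> = (\<Sum>i\<in>{X1, X2}. dcoord i \<and>\<^sub>f (\<lambda>I. partial i (\<alpha> I)))"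

definition Omega :: "nat \<Rightarrow> nat \<Rightarrow> form set" where
  "Omega i j = {\<alpha>. \<forall>I. \<alpha> I \<in> regular_funs \<and>
     (\<alpha> I \<noteq> 0 \<longrightarrow> card (I \<inter> {S1, S2}) = i \<and> card (I \<inter> {X1, X2}) = j)}"

definition omega :: form where
  "omega = (lam1 / s1) *\<^sub>f ds1 + (lam2 / s2) *\<^sub>f ds2
         + (lam3 / QQ) *\<^sub>f d_s (zero_form QQ) + (lam4 / LL) *\<^sub>f d_s (zero_form LL)"

definition omega_X :: form where
  "omega_X = - ((lam4 * s1 / LL) *\<^sub>f dx1) - (lam4 * s2 / LL) *\<^sub>f dx2"

definition nabla :: "form \<Rightarrow> form" where
  "nabla \<alpha> = d_s \<alpha> + omega \<and>\<^sub>f \<alpha>"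

definition nabla_X :: "form \<Rightarrow> form" where
  "nabla_X \<alpha> = d_x \<alpha> + omega_X \<and>\<^sub>f \<alpha>"


section \<open>Classes\<close>

text \<open>
  \<open>cls j \<alpha>\<close> is the class of \<open>\<alpha>\<close> in \<open>\<Omega>\<^sup>2\<^sup>,\<^sup>j(\<XX>) / \<nabla>(\<Omega>\<^sup>1\<^sup>,\<^sup>j(\<XX>))\<close>, as a coset; for
  \<open>j = 0\<close> this quotient is the twisted cohomology group. Classes are added as sets.
\<close>

definition cls :: "nat \<Rightarrow> form \<Rightarrow> form set" where
  "cls j \<alpha> = {\<alpha> + nabla \<beta> | \<beta>. \<beta> \<in> Omega 1 j}"

text \<open>
  The maps on classes induced by \<open>\<nabla>\<^sub>X\<close> and by the wedge product with a 1-form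
  \<open>\<theta>\<close> in \<open>dx\<^sub>1, dx\<^sub>2\<close>. The unions over all representatives are single classes exactly
  when these maps are well defined on \<open>C\<close>.
\<close>

definition nabla_X_cls :: "form set \<Rightarrow> form set" where
  "nabla_X_cls C = (\<Union>\<alpha>\<in>C. cls 1 (nabla_X \<alpha>))"

definition wedge_cls :: "form \<Rightarrow> form set \<Rightarrow> form set" where
  "wedge_cls \<theta> C = (\<Union>\<alpha>\<in>C. cls 1 (\<theta> \<and>\<^sub>f \<alpha>))"

text \<open>The families below are indexed from \<open>0\<close>: \<open>phi ! 0\<close> represents \<open>\<phi>\<^sub>1\<close>.\<close>

definition phi :: "form list" where
  "phi = [(1 / (s1 * s2)) *\<^sub>f ds12,
          (x1 / (s2 * LL)) *\<^sub>f ds12,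
          (x2 / (s1 * LL)) *\<^sub>f ds12,
          (1 / (QQ * LL)) *\<^sub>f ds12]"

definition Xi1_41 :: ratfun where
  "Xi1_41 = (lam1 + lam2 + lam3) / lam3 *
     ((lam1 - lam2) / RR - (lam1 + 2*lam3 + lam4) * (1 + x1 - x2) / (2*x1*RR))"

definition Xi1_42 :: ratfun where
  "Xi1_42 = - ((lam2 - lam4) * (lam2 + 2*lam3 + lam4) / (lam3 * RR))
     + (lam1*lam2 + lam1*lam4 + lam2*lam4 + 2*lam3*lam4 + lam4^2) / (2*lam3)
       * ((1 - x1 - x2) / (x1*RR))"

definition Xi1_43 :: ratfun where
  "Xi1_43 = (lam1*lam2 + lam1*lam4 + lam2*lam4 + 2*lam3*lam4 + lam4^2) / (lam3 * RR)
     - (lam1 - lam4) * (lam1 + lam4 + 2*lam3) / (2*lam3) * ((1 - x1 - x2) / (x1*RR))"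

definition Xi1_44 :: ratfun where
  "Xi1_44 = - ((lam1 - 2*lam3 - 3*lam4 + 2) * (x1 / (2*RR)))
     + (lam1 - lam4 + 1) * ((1 + x2) / RR)
     - (lam1 + 2*lam3 + lam4) * ((x2 - 1)^2 / (2*x1*RR))"

definition Xi2_41 :: ratfun where
  "Xi2_41 = (lam1 + lam2 + lam3) / lam3 *
     ((lam2 - lam1) / RR - (lam2 + 2*lam3 + lam4) * (1 - x1 + x2) / (2*x2*RR))"

definition Xi2_42 :: ratfun where
  "Xi2_42 = (lam1*lam2 + lam1*lam4 + lam2*lam4 + 2*lam3*lam4 + lam4^2) / (lam3 * RR)
     - (lam2 - lam4) * (lam2 + 2*lam3 + lam4) / (2*lam3) * ((1 - x1 - x2) / (x2*RR))"

definition Xi2_43 :: ratfun where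
  "Xi2_43 = - ((lam1 - lam4) * (lam1 + lam4 + 2*lam3) / (lam3 * RR))
     + (lam1*lam2 + lam1*lam4 + lam2*lam4 + 2*lam3*lam4 + lam4^2) / (2*lam3)
       * ((1 - x1 - x2) / (x2*RR))"

definition Xi2_44 :: ratfun where
  "Xi2_44 = - ((lam2 - 2*lam3 - 3*lam4 + 2) * (x2 / (2*RR)))
     + (lam2 - lam4 + 1) * ((x1 + 1) / RR)
     - (lam2 + 2*lam3 + lam4) * ((x1 - 1)^2 / (2*x2*RR))"

definition Xi1 :: "ratfun list list" where
  "Xi1 =
    [[0, - (lam4 / x1), 0, 0],
     [0, - ((lam1 + lam3) / x1), 0, - lam3],
     [- ((lam1 + lam2 + lam3) / (2*x1)), - ((lam2 - lam4) / (2*x1)),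
      - ((lam1 - lam4) / (2*x1)), - (lam3 * (1 - x1 - x2) / (2*x1))],
     [Xi1_41, Xi1_42, Xi1_43, Xi1_44]]"

definition Xi2 :: "ratfun list list" where
  "Xi2 =
    [[0, 0, - (lam4 / x2), 0],
     [- ((lam1 + lam2 + lam3) / (2*x2)), - ((lam2 - lam4) / (2*x2)),
      - ((lam1 - lam4) / (2*x2)), - (lam3 * (1 - x1 - x2) / (2*x2))],
     [0, 0, - ((lam2 + lam3) / x2), - lam3],
     [Xi2_41, Xi2_42, Xi2_43, Xi2_44]]"

definition Xi :: "nat \<Rightarrow> nat \<Rightarrow> form" where
  "Xi i j = (Xi1 ! i ! j) *\<^sub>f dx1 + (Xi2 ! i ! j) *\<^sub>f dx2"

end

theory Submission
  imports Defs
begin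

text \<open>
  Write \<open>D\<^sub>i f = \<partial>\<^sub>i f + c\<^sub>i f\<close> for the covariant derivative in the coordinate \<open>i\<close>, where
  \<open>c\<^sub>i = \<lambda>\<^sub>1 \<partial>\<^sub>i s\<^sub>1/s\<^sub>1 + \<lambda>\<^sub>2 \<partial>\<^sub>i s\<^sub>2/s\<^sub>2 + \<lambda>\<^sub>3 \<partial>\<^sub>i Q/Q + \<lambda>\<^sub>4 \<partial>\<^sub>i L/L\<close> is the logarithmic derivative of
  \<open>s\<^sub>1\<^bsup>\<lambda>\<^sub>1\<^esup> s\<^sub>2\<^bsup>\<lambda>\<^sub>2\<^esup> Q\<^bsup>\<lambda>\<^sub>3\<^esup> L\<^bsup>\<lambda>\<^sub>4\<^esup>\<close>. Then \<open>\<nabla> = \<Sum> ds\<^sub>i \<and> D\<^sub>i\<close> and \<open>\<nabla>\<^sub>X = \<Sum> dx\<^sub>k \<and> D\<^sub>k\<close>. The operators \<open>D\<^sub>i\<close>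
  commute because logarithmic derivatives are closed, and the operators \<open>dz \<and>\<close> anticommute, so
  \<open>\<nabla>\<^sub>X \<nabla> = - \<nabla> \<nabla>\<^sub>X\<close>. Likewise \<open>\<theta> \<and> \<nabla>\<beta> = - \<nabla>(\<theta> \<and> \<beta>)\<close> for a 1-form \<open>\<theta>\<close> in \<open>dx\<^sub>1, dx\<^sub>2\<close> whose
  coefficients do not involve \<open>s\<^sub>1, s\<^sub>2\<close>. Hence both maps are well defined on classes, and with
  \<open>\<phi>\<^sub>i = f\<^sub>i ds\<^sub>1\<^sub>2\<close> the theorem says that for all \<open>i\<close> and \<open>k\<close> the function
  \<open>D\<^sub>x\<^sub>k f\<^sub>i - \<Sum>\<^sub>j \<Xi>\<^sup>k\<^sub>i\<^sub>j f\<^sub>j\<close> has the form \<open>D\<^sub>s\<^sub>1 g + D\<^sub>s\<^sub>2 h\<close> with regular \<open>g, h\<close>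
  (\<open>nabla_X_cls_eq_wedge_sum\<close>).

  The functions \<open>g, h\<close> come from the vector fields \<open>s\<^sub>1 Q \<partial>\<^sub>s\<^sub>1\<close>, \<open>s\<^sub>2 Q \<partial>\<^sub>s\<^sub>2\<close> and
  \<open>s\<^sub>2\<^sup>2 \<partial>\<^sub>s\<^sub>2 - s\<^sub>1\<^sup>2 \<partial>\<^sub>s\<^sub>1\<close>, which are tangent to the divisor \<open>s\<^sub>1 s\<^sub>2 Q = 0\<close>: each maps \<open>s\<^sub>1\<close>, \<open>s\<^sub>2\<close> and
  \<open>Q\<close> to multiples of themselves. A combination of them with polynomial
  coefficients \<open>\<beta>, \<gamma>, \<alpha>\<close>, divided by \<open>s\<^sub>1 s\<^sub>2 Q L\<close>, has a twisted divergence whose poles are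
  at most simple along \<open>s\<^sub>1 s\<^sub>2 Q = 0\<close> and at most double along \<open>L = 0\<close>, as are those of
  \<open>D\<^sub>x\<^sub>k f\<^sub>i\<close>. Multiplying by \<open>s\<^sub>1 s\<^sub>2 Q L\<^sup>2\<close> turns each row of the theorem into a polynomial
  identity (\<open>reduction\<close>), and \<open>\<alpha>, \<beta>, \<gamma>\<close> are found by solving linear equations for their coefficients.
  Exchanging the indices \<open>1\<close> and \<open>2\<close> of \<open>s\<close>, \<open>x\<close> and \<open>\<lambda>\<close>, and with them \<open>f\<^sub>2\<close> and \<open>f\<^sub>3\<close>, carries
  \<open>\<Xi>\<^sup>1\<close> to \<open>\<Xi>\<^sup>2\<close>, so the computation is done once, in a locale that is interpreted twice.
\<close>

section \<open>Derivations\<close>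

lemma
  fixes D :: "'a::comm_ring_1 \<Rightarrow> 'a"
  assumes "is_derivation D"
  shows derivation_add: "D (f + g) = D f + D g"
    and derivation_mult: "D (f * g) = D f * g + f * D g"
    and derivation_0: "D 0 = 0"
    and derivation_1: "D 1 = 0"
    and derivation_minus: "D (- f) = - D f"
    and derivation_diff: "D (f - g) = D f - D g"
    and derivation_numeral: "D (numeral n) = 0"
proof -
  show add: "D (f + g) = D f + D g" for f g
    using assms by (simp add: is_derivation_def)
  show mult: "D (f * g) = D f * g + f * D g" for f g
    using assms by (simp add: is_derivation_def)
  show zero: "D 0 = 0"
    using add[of 0 0] by (metis add.right_neutral add_cancel_left_right)
  show one: "D 1 = 0"
    using mult[of 1 1] by (metis add_cancel_left_right mult.left_neutral mult.right_neutral)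
  show minus: "D (- f) = - D f" for f
    using add[of f "- f"] zero by (simp add: eq_neg_iff_add_eq_0 add.commute)
  show "D (f - g) = D f - D g"
    using add[of f "- g"] minus by simp
  show "D (numeral n) = 0"
    by (induction n) (simp_all only: numeral.simps one add add_0)
qed

lemma derivation_divide:
  fixes D :: "'a::field \<Rightarrow> 'a"
  assumes "is_derivation D" "g \<noteq> 0"
  shows "D (f / g) = (D f * g - f * D g) / g\<^sup>2"
proof -
  have "D f = D (f / g) * g + f / g * D g"
    using derivation_mult[OF assms(1), of "f / g" g] assms(2) by simp
  with assms(2) show ?thesis
    by (simp add: field_simps power2_eq_square)
qed

lemma pderiv_map_poly_derivation:
  fixes D :: "'a::idom \<Rightarrow> 'a"
  assumes "is_derivation D"
  shows "pderiv (map_poly D p) = map_poly D (pderiv p)"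
proof -
  note [simp] = derivation_0[OF assms]
  have "D (of_nat n * c) = of_nat n * D c" for n c
    by (induction n) (simp_all add: derivation_add[OF assms] distrib_right)
  then have "D (coeff (pderiv p) n) = of_nat (Suc n) * D (coeff p (Suc n))" for n
    by (simp only: coeff_pderiv)
  then show ?thesis
    by (simp add: poly_eq_iff coeff_map_poly coeff_pderiv del: of_nat_Suc)
qed

lemma map_poly_commute:
  assumes "\<And>c. D (E c) = E (D c)" "D 0 = 0" "E 0 = 0"
  shows "map_poly D (map_poly E p) = map_poly E (map_poly D p)"
  using assms by (simp add: poly_eq_iff coeff_map_poly)

lemma poly_partial_commute:
  "poly_partial i (poly_partial j p) = poly_partial j (poly_partial i p)"
  by (cases i; cases j)
    (simp_all add: pderiv_map_poly_derivation is_derivation_pderiv is_derivation_map_poly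
      map_poly_commute)

lemma partial_to_fract: "partial i (to_fract p) = to_fract (poly_partial i p)"
  by (simp add: to_fract_def partial_Fract derivation_1[OF is_derivation_poly_partial])

lemma is_derivation_partial: "is_derivation (partial i)"
  unfolding is_derivation_def
proof (intro conjI allI)
  fix f g :: ratfun
  obtain p q where f: "f = Fract p q" "q \<noteq> 0" by (cases f)
  obtain u v where g: "g = Fract u v" "v \<noteq> 0" by (cases g)
  note D = derivation_add[OF is_derivation_poly_partial]
    derivation_mult[OF is_derivation_poly_partial]
  show "partial i (f + g) = partial i f + partial i g"
    using f(2) g(2) unfolding f(1) g(1)
    by (simp add: partial_Fract eq_fract D power2_eq_square) (simp add: algebra_simps)
  show "partial i (f * g) = partial i f * g + f * partial i g"
    using f(2) g(2) unfolding f(1) g(1)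
    by (simp add: partial_Fract eq_fract D power2_eq_square) (simp add: algebra_simps)
qed

lemmas partial_add = is_derivation_partial[THEN derivation_add]
  and partial_mult = is_derivation_partial[THEN derivation_mult]
  and partial_0 [simp] = is_derivation_partial[THEN derivation_0]
  and partial_1 [simp] = is_derivation_partial[THEN derivation_1]
  and partial_minus = is_derivation_partial[THEN derivation_minus]
  and partial_diff = is_derivation_partial[THEN derivation_diff]
  and partial_numeral = is_derivation_partial[THEN derivation_numeral]
  and partial_divide = is_derivation_partial[THEN derivation_divide]

text \<open>
  The commutator of two derivations is again a derivation, and one that vanishes on polynomials
  vanishes on all fractions.
\<close>

lemma partial_commute: "partial i (partial j f) = partial j (partial i f)"
proof -
  define C where "C f = partial i (partial j f) - partial j (partial i f)" for f
  obtain p q where f: "f = Fract p q" and q: "q \<noteq> 0" by (cases f)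
  have mult: "C (a * b) = C a * b + a * C b" for a b
    by (simp add: C_def partial_add partial_mult algebra_simps)
  have "C (to_fract u) = 0" for u
    by (simp add: C_def partial_to_fract poly_partial_commute)
  moreover have "f * to_fract q = to_fract p"
    using q by (simp add: f to_fract_def eq_fract)
  ultimately have "C f * to_fract q = 0"
    using mult[of f "to_fract q"] by simp
  with q have "C f = 0" by simp
  then show ?thesis by (simp add: C_def)
qed

lemma partial_const [simp]: "partial i (const c) = 0"
  unfolding const_def partial_to_fract by (cases i) (simp_all add: map_poly_pCons pderiv_pCons)

lemma partial_coordinates [simp]:
  "partial S1 s1 = 1" "partial S1 s2 = 0" "partial S1 x1 = 0" "partial S1 x2 = 0"
  "partial S2 s1 = 0" "partial S2 s2 = 1" "partial S2 x1 = 0" "partial S2 x2 = 0"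
  "partial X1 s1 = 0" "partial X1 s2 = 0" "partial X1 x1 = 1" "partial X1 x2 = 0"
  "partial X2 s1 = 0" "partial X2 s2 = 0" "partial X2 x1 = 0" "partial X2 x2 = 1"
  unfolding s1_def s2_def x1_def x2_def partial_to_fract
  by (simp_all add: map_poly_pCons pderiv_pCons one_pCons[symmetric] map_poly_1)

lemma partial_lam [simp]:
  "partial i lam1 = 0" "partial i lam2 = 0" "partial i lam3 = 0" "partial i lam4 = 0"
  by (simp_all add: lam1_def lam2_def lam3_def lam4_def)

lemma partial_divisors:
  "partial S1 QQ = s2 - 1" "partial S2 QQ = s1 - 1" "partial X1 QQ = 0" "partial X2 QQ = 0"
  "partial S1 LL = - x1" "partial S2 LL = - x2" "partial X1 LL = - s1" "partial X2 LL = - s2"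
  "partial S1 RR = 0" "partial S2 RR = 0"
  by (simp_all add: QQ_def LL_def RR_def power2_eq_square partial_add partial_diff partial_mult
      partial_numeral)


section \<open>Regular functions\<close>

lemma const_hom:
  "const (c + d) = const c + const d" "const (c * d) = const c * const d" "const 1 = 1"
  "const 0 = 0" "const (- c) = - const c"
  by (simp_all add: const_def to_fract_add[symmetric] to_fract_mult[symmetric] one_pCons[symmetric]
      to_fract_uminus[symmetric])

lemma const_eq_0_iff: "const c = 0 \<longleftrightarrow> c = 0"
  by (simp add: const_def)

lemma two_neq_zero: "(2::ratfun) \<noteq> 0"
proof -
  have "(2::complex poly poly poly poly) \<noteq> 0"
    by simp
  then have "to_fract (2::complex poly poly poly poly) \<noteq> 0"
    by (simp only: to_fract_eq_0_iff not_False_eq_True)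
  moreover have "to_fract (2::complex poly poly poly poly) = 1 + 1"
    by (simp flip: to_fract_add to_fract_1)
  ultimately have "(1 + 1 :: param_field) \<noteq> 0"
    by simp
  then have "const (1 + 1) \<noteq> 0"
    by (simp only: const_eq_0_iff not_False_eq_True)
  then show ?thesis
    by (metis const_hom(1,3) one_add_one)
qed

lemma lam3_neq_zero: "lam3 \<noteq> 0"
proof -
  have "par_c1 + par_c2 - par_a - 2 = par_c1 + par_c2 - par_a - (1 + 1)"
    by simp
  also have "\<dots> = to_fract [:[:[:[:- 2, 1:], 1:]:], -1:]"
    unfolding par_a_def par_c1_def par_c2_def to_fract_add[symmetric]
      to_fract_diff[symmetric] to_fract_1[symmetric] one_pCons by simp
  also have "\<dots> \<noteq> 0" by simp
  finally show ?thesis by (simp add: lam3_def const_eq_0_iff)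
qed

lemma nonzero_divisors:
  "s1 \<noteq> 0" "s2 \<noteq> 0" "x1 \<noteq> 0" "x2 \<noteq> 0" "QQ \<noteq> 0" "LL \<noteq> 0" "RR \<noteq> 0"
proof -
  show "s1 \<noteq> 0" "s2 \<noteq> 0" "x1 \<noteq> 0" "x2 \<noteq> 0"
    by (simp_all add: s1_def s2_def x1_def x2_def)
  show "QQ \<noteq> 0"
    by (simp add: QQ_def s1_def s2_def flip: to_fract_mult to_fract_diff)
  show "LL \<noteq> 0"
    by (simp add: LL_def s1_def s2_def x1_def x2_def one_pCons
        flip: to_fract_mult to_fract_diff to_fract_1)
  define X :: coord_poly where "X = [:[:[:0, 1:]:]:]"
  define Y :: coord_poly where "Y = [:[:[:[:0, 1:]:]:]:]"
  have "RR = x1 * x1 + x2 * x2 - (x1 * x2 + x1 * x2) - (x1 + x1) - (x2 + x2) + 1"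
    by (simp add: RR_def power2_eq_square algebra_simps)
  also have "\<dots> = to_fract (X * X + Y * Y - (X * Y + X * Y) - (X + X) - (Y + Y) + 1)"
    by (simp only: x1_def x2_def X_def Y_def to_fract_add to_fract_diff to_fract_mult to_fract_1)
  also have "\<dots> \<noteq> 0"
    by (simp add: X_def Y_def one_pCons)
  finally show "RR \<noteq> 0" .
qed

definition boundary :: ratfun where
  "boundary = s1 * s2 * QQ * LL * x1 * x2 * RR"

lemma boundary_neq_zero: "boundary \<noteq> 0"
  by (simp add: boundary_def nonzero_divisors)

lemma boundary_polynomial:
  obtains b where "boundary = to_fract b"
proof -
  define P :: "ratfun set" where "P = range to_fract"
  have closed: "f + g \<in> P" "f - g \<in> P" "f * g \<in> P" if "f \<in> P" "g \<in> P" for f g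
    using that unfolding P_def
    by (auto simp flip: to_fract_add to_fract_diff to_fract_mult)
  have one: "1 \<in> P"
    unfolding P_def by (simp flip: to_fract_1)
  have two: "2 \<in> P"
    using closed(1)[OF one one] by simp
  have coordinates: "s1 \<in> P" "s2 \<in> P" "x1 \<in> P" "x2 \<in> P"
    by (simp_all add: P_def s1_def s2_def x1_def x2_def)
  have "boundary \<in> P"
    unfolding boundary_def QQ_def LL_def RR_def power2_eq_square
    by (intro closed one two coordinates)
  then show thesis
    using that by (auto simp: P_def)
qed

lemma regular_iff: "f \<in> regular_funs \<longleftrightarrow> (\<exists>n p. f * boundary ^ n = to_fract p)"
  by (simp add: regular_funs_def boundary_def)

lemma to_fract_power: "to_fract (b ^ n) = to_fract b ^ n"
  by (induction n) simp_all

lemma regular_add: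
  assumes "f \<in> regular_funs" "g \<in> regular_funs"
  shows "f + g \<in> regular_funs"
proof -
  obtain n p where f: "f * boundary ^ n = to_fract p"
    using assms(1) by (auto simp: regular_iff)
  obtain m q where g: "g * boundary ^ m = to_fract q"
    using assms(2) by (auto simp: regular_iff)
  obtain b where b: "boundary = to_fract b"
    by (rule boundary_polynomial)
  have "(f + g) * boundary ^ (n + m)
      = (f * boundary ^ n) * boundary ^ m + (g * boundary ^ m) * boundary ^ n"
    by (simp add: power_add algebra_simps)
  also have "\<dots> = to_fract (p * b ^ m + q * b ^ n)"
    unfolding f g unfolding b by (simp add: to_fract_power)
  finally show ?thesis
    unfolding regular_iff by blast
qed

lemma regular_mult:
  assumes "f \<in> regular_funs" "g \<in> regular_funs"
  shows "f * g \<in> regular_funs"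
proof -
  obtain n p where f: "f * boundary ^ n = to_fract p"
    using assms(1) by (auto simp: regular_iff)
  obtain m q where g: "g * boundary ^ m = to_fract q"
    using assms(2) by (auto simp: regular_iff)
  have "(f * g) * boundary ^ (n + m) = (f * boundary ^ n) * (g * boundary ^ m)"
    by (simp add: power_add)
  also have "\<dots> = to_fract (p * q)"
    unfolding f g by simp
  finally show ?thesis
    unfolding regular_iff by blast
qed

lemma regular_to_fract: "to_fract p \<in> regular_funs"
  unfolding regular_iff by (rule exI[of _ 0]) auto

lemma regular_const: "const c \<in> regular_funs"
  unfolding const_def by (rule regular_to_fract)

lemma regular_0: "0 \<in> regular_funs" and regular_1: "1 \<in> regular_funs"
  using regular_const[of 0] regular_const[of 1] by (simp_all add: const_hom)

lemma regular_minus: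
  assumes "f \<in> regular_funs"
  shows "- f \<in> regular_funs"
  using regular_mult[OF regular_const[of "- 1"] assms] by (simp add: const_hom)

lemma regular_diff:
  assumes "f \<in> regular_funs" "g \<in> regular_funs"
  shows "f - g \<in> regular_funs"
  using regular_add[OF assms(1) regular_minus[OF assms(2)]] by simp

lemma regular_power: "f \<in> regular_funs \<Longrightarrow> f ^ n \<in> regular_funs"
  by (induction n) (simp_all add: regular_1 regular_mult)

lemma regular_numeral: "numeral n \<in> regular_funs"
  by (induction n) (simp_all only: numeral.simps regular_1 regular_add)

lemma regular_coordinates:
  "s1 \<in> regular_funs" "s2 \<in> regular_funs" "x1 \<in> regular_funs" "x2 \<in> regular_funs"
  unfolding s1_def s2_def x1_def x2_def by (rule regular_to_fract)+

lemma regular_lam: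
  "lam1 \<in> regular_funs" "lam2 \<in> regular_funs" "lam3 \<in> regular_funs" "lam4 \<in> regular_funs"
  unfolding lam1_def lam2_def lam3_def lam4_def by (rule regular_const)+

lemma regular_QLR: "QQ \<in> regular_funs" "LL \<in> regular_funs" "RR \<in> regular_funs"
  unfolding QQ_def LL_def RR_def
  by (intro regular_add regular_diff regular_mult regular_coordinates regular_1 regular_numeral
      regular_power)+

lemma regular_inverse_boundary: "inverse boundary \<in> regular_funs"
  unfolding regular_iff
  by (rule exI[of _ 1], rule exI[of _ 1]) (simp add: boundary_neq_zero)

lemma regular_inverse_factor:
  assumes "f * g = boundary" "g \<in> regular_funs"
  shows "inverse f \<in> regular_funs"
proof -
  have "inverse f = g * inverse boundary"
    using boundary_neq_zero unfolding assms(1)[symmetric] by simp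
  then show ?thesis
    using assms(2) regular_inverse_boundary by (simp add: regular_mult)
qed

lemma regular_inverse_divisors:
  "inverse s1 \<in> regular_funs" "inverse s2 \<in> regular_funs" "inverse x1 \<in> regular_funs"
  "inverse x2 \<in> regular_funs" "inverse QQ \<in> regular_funs" "inverse LL \<in> regular_funs"
  "inverse RR \<in> regular_funs"
proof -
  note rules = regular_mult regular_coordinates regular_QLR
  show "inverse s1 \<in> regular_funs"
    by (rule regular_inverse_factor[where g = "s2 * QQ * LL * x1 * x2 * RR"]; (intro rules)?)
      (simp add: boundary_def)
  show "inverse s2 \<in> regular_funs"
    by (rule regular_inverse_factor[where g = "s1 * QQ * LL * x1 * x2 * RR"]; (intro rules)?)
      (simp add: boundary_def)
  show "inverse x1 \<in> regular_funs"
    by (rule regular_inverse_factor[where g = "s1 * s2 * QQ * LL * x2 * RR"]; (intro rules)?)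
      (simp add: boundary_def)
  show "inverse x2 \<in> regular_funs"
    by (rule regular_inverse_factor[where g = "s1 * s2 * QQ * LL * x1 * RR"]; (intro rules)?)
      (simp add: boundary_def)
  show "inverse QQ \<in> regular_funs"
    by (rule regular_inverse_factor[where g = "s1 * s2 * LL * x1 * x2 * RR"]; (intro rules)?)
      (simp add: boundary_def)
  show "inverse LL \<in> regular_funs"
    by (rule regular_inverse_factor[where g = "s1 * s2 * QQ * x1 * x2 * RR"]; (intro rules)?)
      (simp add: boundary_def)
  show "inverse RR \<in> regular_funs"
    by (rule regular_inverse_factor[where g = "s1 * s2 * QQ * LL * x1 * x2"]; (intro rules)?)
      (simp add: boundary_def)
qed

lemma regular_inverse_const: "inverse (const c) \<in> regular_funs"
proof (cases "c = 0")
  case False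
  then have "const c * const (inverse c) = 1"
    by (simp flip: const_hom)
  then have "inverse (const c) = const (inverse c)"
    by (rule inverse_unique)
  then show ?thesis by (simp add: regular_const)
qed (simp add: const_hom regular_0)

lemma regular_inverse_lam3: "inverse lam3 \<in> regular_funs"
  unfolding lam3_def by (rule regular_inverse_const)

lemma regular_inverse_2: "inverse 2 \<in> regular_funs"
  using regular_inverse_const[of "1 + 1"] by (metis const_hom(1,3) one_add_one)

lemma regular_inverse_mult:
  "inverse f \<in> regular_funs \<Longrightarrow> inverse g \<in> regular_funs \<Longrightarrow> inverse (f * g) \<in> regular_funs"
  by (simp add: regular_mult)

lemma regular_divide:
  "f \<in> regular_funs \<Longrightarrow> inverse g \<in> regular_funs \<Longrightarrow> f / g \<in> regular_funs"
  by (simp add: divide_inverse regular_mult)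

lemmas regular_intros = regular_add regular_diff regular_minus regular_mult regular_divide
  regular_power regular_0 regular_1 regular_numeral regular_coordinates regular_lam regular_QLR
  regular_inverse_divisors regular_inverse_lam3 regular_inverse_2 regular_inverse_mult

lemma regular_partial:
  assumes "f \<in> regular_funs"
  shows "partial i f \<in> regular_funs"
proof -
  have reg: "partial i (to_fract p) \<in> regular_funs" for p
    unfolding partial_to_fract by (rule regular_to_fract)
  obtain b where b: "boundary = to_fract b"
    by (rule boundary_polynomial)
  obtain n p where f: "f * boundary ^ n = to_fract p"
    using assms by (auto simp: regular_iff)
  have "partial i f * boundary ^ n = partial i (to_fract p) - f * partial i (to_fract (b ^ n))"
    unfolding f[symmetric] partial_mult b to_fract_power by simp
  then have "partial i f
      = (partial i (to_fract p) - f * partial i (to_fract (b ^ n))) * inverse boundary ^ n"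
    using boundary_neq_zero by (simp add: field_simps)
  then show ?thesis
    by (simp add: reg assms regular_diff regular_mult regular_power regular_inverse_boundary)
qed

text \<open>The functions pulled back from \<open>X\<close>.\<close>

definition base_funs :: "ratfun set" where
  "base_funs = {f \<in> regular_funs. partial S1 f = 0 \<and> partial S2 f = 0}"

lemma base_divide:
  assumes "f \<in> base_funs" "g \<in> base_funs" "inverse g \<in> regular_funs"
  shows "f / g \<in> base_funs"
  using assms
  by (cases "g = 0") (simp_all add: base_funs_def regular_divide regular_0 partial_divide)

lemma base_intros:
  "f \<in> base_funs \<Longrightarrow> g \<in> base_funs \<Longrightarrow> f + g \<in> base_funs"
  "f \<in> base_funs \<Longrightarrow> g \<in> base_funs \<Longrightarrow> f - g \<in> base_funs"
  "f \<in> base_funs \<Longrightarrow> g \<in> base_funs \<Longrightarrow> f * g \<in> base_funs"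
  "f \<in> base_funs \<Longrightarrow> - f \<in> base_funs"
  "0 \<in> base_funs" "1 \<in> base_funs" "numeral n \<in> base_funs" "x1 \<in> base_funs" "x2 \<in> base_funs"
  "lam1 \<in> base_funs" "lam2 \<in> base_funs" "lam3 \<in> base_funs" "lam4 \<in> base_funs" "RR \<in> base_funs"
  by (simp_all add: base_funs_def partial_add partial_diff partial_mult partial_minus
      partial_numeral partial_divisors regular_intros)


section \<open>Covariant derivatives\<close>

definition conn :: "coord \<Rightarrow> ratfun" where
  "conn i = lam1 * (partial i s1 / s1) + lam2 * (partial i s2 / s2)
    + lam3 * (partial i QQ / QQ) + lam4 * (partial i LL / LL)"

definition cov :: "coord \<Rightarrow> ratfun \<Rightarrow> ratfun" where
  "cov i f = partial i f + conn i * f"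

lemma conn_eq:
  "conn S1 = lam1 / s1 + lam3 / QQ * (s2 - 1) + lam4 / LL * (- x1)"
  "conn S2 = lam2 / s2 + lam3 / QQ * (s1 - 1) + lam4 / LL * (- x2)"
  "conn X1 = - (lam4 * s1 / LL)"
  "conn X2 = - (lam4 * s2 / LL)"
  by (simp_all add: conn_def partial_divisors)

lemma partial_log_derivative_commute:
  assumes "g \<noteq> 0"
  shows "partial i (partial j g / g) = partial j (partial i g / g)"
  using assms by (simp add: partial_divide partial_commute[of i j] mult.commute)

lemma partial_conn_commute: "partial i (conn j) = partial j (conn i)"
  unfolding conn_def partial_add partial_mult partial_lam
  using partial_log_derivative_commute nonzero_divisors by simp

text \<open>
  This is the flatness of the total connection \<open>\<nabla> + \<nabla>\<^sub>X\<close>; for one index among \<open>s\<^sub>1, s\<^sub>2\<close> and one among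
  \<open>x\<^sub>1, x\<^sub>2\<close> it makes \<open>\<nabla>\<^sub>X\<close> act on classes.
\<close>

lemma cov_commute: "cov i (cov j f) = cov j (cov i f)"
  unfolding cov_def
  using partial_conn_commute[of i j] partial_commute[of i j f]
  by (simp add: partial_add partial_mult algebra_simps)

lemma cov_0 [simp]: "cov i 0 = 0"
  by (simp add: cov_def)

lemma cov_add: "cov i (f + g) = cov i f + cov i g"
  by (simp add: cov_def partial_add algebra_simps)

lemma cov_mult: "cov i (f * g) = partial i f * g + f * cov i g"
  by (simp add: cov_def partial_mult algebra_simps)

lemma cov_minus: "cov i (- f) = - cov i f"
  by (simp add: cov_def partial_minus)

lemma regular_cov: "f \<in> regular_funs \<Longrightarrow> cov i f \<in> regular_funs"
  unfolding cov_def conn_def by (intro regular_intros regular_partial)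


section \<open>Calculus of forms\<close>

lemma finite_coords [simp]: "finite (K :: coord set)"
proof -
  have "UNIV = {S1, S2, X1, X2}"
    using coord.exhaust by blast
  then have "finite (UNIV :: coord set)"
    by (metis finite.emptyI finite.insertI)
  then show ?thesis
    by (rule rev_finite_subset) simp
qed

lemma wedge_add_left: "(\<alpha> + \<beta>) \<and>\<^sub>f \<gamma> = \<alpha> \<and>\<^sub>f \<gamma> + \<beta> \<and>\<^sub>f \<gamma>"
  and wedge_add_right: "\<alpha> \<and>\<^sub>f (\<beta> + \<gamma>) = \<alpha> \<and>\<^sub>f \<beta> + \<alpha> \<and>\<^sub>f \<gamma>"
  and wedge_minus_right: "\<alpha> \<and>\<^sub>f (- \<gamma>) = - (\<alpha> \<and>\<^sub>f \<gamma>)"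
  and wedge_scale_left: "(f *\<^sub>f \<alpha>) \<and>\<^sub>f \<beta> = f *\<^sub>f (\<alpha> \<and>\<^sub>f \<beta>)"
  and wedge_scale_right: "\<alpha> \<and>\<^sub>f (f *\<^sub>f \<beta>) = f *\<^sub>f (\<alpha> \<and>\<^sub>f \<beta>)"
  by (simp_all add: fun_eq_iff wedge_def scale_def algebra_simps sum.distrib sum_distrib_left
      sum_negf)

lemma scale_add: "f *\<^sub>f (\<alpha> + \<beta>) = f *\<^sub>f \<alpha> + f *\<^sub>f \<beta>"
  and scale_minus: "f *\<^sub>f (- \<alpha>) = - (f *\<^sub>f \<alpha>)"
  and scale_scale: "f *\<^sub>f g *\<^sub>f \<alpha> = (f * g) *\<^sub>f \<alpha>"
  and add_scale: "(f + g) *\<^sub>f \<alpha> = f *\<^sub>f \<alpha> + g *\<^sub>f \<alpha>"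
  and minus_scale: "(- f) *\<^sub>f \<alpha> = - (f *\<^sub>f \<alpha>)"
  by (simp_all add: fun_eq_iff scale_def algebra_simps)

lemma dcoord_wedge:
  "(dcoord i \<and>\<^sub>f \<alpha>) I = (if i \<in> I then shuffle_sign {i} (I - {i}) * \<alpha> (I - {i}) else 0)"
proof -
  have "(dcoord i \<and>\<^sub>f \<alpha>) I
      = (\<Sum>J\<in>Pow I. if J = {i} then shuffle_sign J (I - J) * \<alpha> (I - J) else 0)"
    unfolding wedge_def dcoord_def by (intro sum.cong) auto
  also have "\<dots> = (if i \<in> I then shuffle_sign {i} (I - {i}) * \<alpha> (I - {i}) else 0)"
    by (subst sum.delta) auto
  finally show ?thesis .
qed

lemma shuffle_sign_insert:
  assumes "j \<notin> K"
  shows "shuffle_sign {i} (insert j K)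
    = (if position j < position i then - 1 else 1) * shuffle_sign {i} K"
proof -
  let ?A = "{(i', k). i' \<in> {i} \<and> k \<in> K \<and> position k < position i'}"
  have "{(i', k). i' \<in> {i} \<and> k \<in> insert j K \<and> position k < position i'} =
     (if position j < position i then insert (i, j) ?A else ?A)"
    by auto
  moreover have "finite ?A"
    by (rule finite_subset[of _ "{i} \<times> K"]) auto
  ultimately show ?thesis
    using assms by (simp add: shuffle_sign_def)
qed

text \<open>
  Of the two orders in which \<open>i\<close> and \<open>j\<close> can be split off, exactly one costs an extra transposition.
\<close>

lemma dcoord_wedge_anticommute:
  "dcoord i \<and>\<^sub>f (dcoord j \<and>\<^sub>f \<alpha>) = - (dcoord j \<and>\<^sub>f (dcoord i \<and>\<^sub>f \<alpha>))"
proof (cases "i = j")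
  case True
  then show ?thesis by (simp add: fun_eq_iff dcoord_wedge)
next
  case False
  have less: "position i < position j \<longleftrightarrow> \<not> position j < position i"
    using False by (cases i; cases j) simp_all
  have "(dcoord i \<and>\<^sub>f (dcoord j \<and>\<^sub>f \<alpha>)) I = - (dcoord j \<and>\<^sub>f (dcoord i \<and>\<^sub>f \<alpha>)) I" for I
  proof (cases "i \<in> I \<and> j \<in> I")
    case True
    define K where "K = I - {i, j}"
    have K: "I - {i} - {j} = K" "I - {j} - {i} = K" "I - {i} = insert j K" "I - {j} = insert i K"
      "i \<notin> K" "j \<notin> K"
      using True False by (auto simp: K_def)
    with True False show ?thesis
      by (simp add: dcoord_wedge K shuffle_sign_insert[OF K(5)] shuffle_sign_insert[OF K(6)] less)
  qed (auto simp: dcoord_wedge)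
  then show ?thesis by (simp add: fun_eq_iff)
qed

lemma dcoord_wedge_zero_form: "dcoord i \<and>\<^sub>f zero_form f = f *\<^sub>f dcoord i"
proof
  fix I
  have "i \<in> I \<Longrightarrow> I - {i} = {} \<longleftrightarrow> I = {i}"
    by blast
  moreover have "shuffle_sign {i} {} = 1"
    by (simp add: shuffle_sign_def)
  ultimately show "(dcoord i \<and>\<^sub>f zero_form f) I = (f *\<^sub>f dcoord i) I"
    unfolding dcoord_wedge unfolding zero_form_def scale_def dcoord_def
    by (cases "I = {i}") simp_all
qed

lemma d_s_zero_form: "d_s (zero_form f) = partial S1 f *\<^sub>f ds1 + partial S2 f *\<^sub>f ds2"
proof -
  have "(\<lambda>I. partial i (zero_form f I)) = zero_form (partial i f)" for i
    by (simp add: zero_form_def fun_eq_iff)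
  then show ?thesis
    by (simp add: d_s_def dcoord_wedge_zero_form)
qed

lemma omega_eq: "omega = conn S1 *\<^sub>f ds1 + conn S2 *\<^sub>f ds2"
  unfolding omega_def d_s_zero_form conn_eq partial_divisors
  by (simp only: scale_add scale_scale add_scale add_ac)

lemma omega_X_eq: "omega_X = conn X1 *\<^sub>f dx1 + conn X2 *\<^sub>f dx2"
  unfolding omega_X_def conn_eq diff_conv_add_uminus by (simp only: minus_scale)

definition cov_form :: "coord \<Rightarrow> form \<Rightarrow> form" where
  "cov_form i \<alpha> = (\<lambda>I. cov i (\<alpha> I))"

lemma dcoord_wedge_cov:
  "dcoord i \<and>\<^sub>f cov_form i \<alpha>
    = dcoord i \<and>\<^sub>f (\<lambda>I. partial i (\<alpha> I)) + (conn i *\<^sub>f dcoord i) \<and>\<^sub>f \<alpha>"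
proof -
  have "cov_form i \<alpha> = (\<lambda>I. partial i (\<alpha> I)) + conn i *\<^sub>f \<alpha>"
    by (simp add: cov_form_def cov_def scale_def fun_eq_iff)
  then show ?thesis
    by (simp add: wedge_add_right wedge_scale_left wedge_scale_right)
qed

lemma nabla_eq: "nabla \<alpha> = ds1 \<and>\<^sub>f cov_form S1 \<alpha> + ds2 \<and>\<^sub>f cov_form S2 \<alpha>"
  by (simp add: nabla_def d_s_def omega_eq wedge_add_left dcoord_wedge_cov add_ac)

lemma nabla_X_eq: "nabla_X \<alpha> = dx1 \<and>\<^sub>f cov_form X1 \<alpha> + dx2 \<and>\<^sub>f cov_form X2 \<alpha>"
  by (simp add: nabla_X_def d_x_def omega_X_eq wedge_add_left dcoord_wedge_cov add_ac)

lemma cov_form_add: "cov_form i (\<alpha> + \<beta>) = cov_form i \<alpha> + cov_form i \<beta>"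
  and cov_form_minus: "cov_form i (- \<alpha>) = - cov_form i \<alpha>"
  by (simp_all add: cov_form_def fun_eq_iff cov_add cov_minus)

lemma cov_form_commute: "cov_form i (cov_form j \<alpha>) = cov_form j (cov_form i \<alpha>)"
  by (simp add: cov_form_def fun_eq_iff cov_commute)

lemma cov_form_scale:
  "cov_form i (f *\<^sub>f \<alpha>) = partial i f *\<^sub>f \<alpha> + f *\<^sub>f cov_form i \<alpha>"
  by (simp add: cov_form_def scale_def fun_eq_iff cov_mult)

lemma cov_form_dcoord_wedge: "cov_form i (dcoord j \<and>\<^sub>f \<alpha>) = dcoord j \<and>\<^sub>f cov_form i \<alpha>"
proof -
  have sgn: "cov i ((- 1) ^ n * f) = (- 1) ^ n * cov i f" for n f
    by (induction n) (simp_all add: cov_minus)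
  show ?thesis
    by (simp add: cov_form_def fun_eq_iff dcoord_wedge shuffle_sign_def sgn)
qed

lemma cov_form_scale_dcoord: "cov_form i (f *\<^sub>f dcoord j) = cov i f *\<^sub>f dcoord j"
  by (auto simp: fun_eq_iff cov_form_def scale_def dcoord_def)

lemma cov_form_scale_ds12: "cov_form i (f *\<^sub>f ds12) = cov i f *\<^sub>f ds12"
  unfolding wedge_scale_right[symmetric] cov_form_dcoord_wedge cov_form_scale_dcoord ..

lemma nabla_add: "nabla (\<alpha> + \<beta>) = nabla \<alpha> + nabla \<beta>"
  and nabla_minus: "nabla (- \<alpha>) = - nabla \<alpha>"
  and nabla_X_add: "nabla_X (\<alpha> + \<beta>) = nabla_X \<alpha> + nabla_X \<beta>"
  by (simp_all add: nabla_eq nabla_X_eq cov_form_add cov_form_minus wedge_add_right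
      wedge_minus_right add_ac)

lemma nabla_0: "nabla 0 = 0"
  using nabla_add[of 0 0] by simp

lemma nabla_dcoord_wedge: "nabla (dcoord k \<and>\<^sub>f \<alpha>) = - (dcoord k \<and>\<^sub>f nabla \<alpha>)"
  by (simp add: nabla_eq cov_form_dcoord_wedge wedge_add_right
      dcoord_wedge_anticommute[of S1 k] dcoord_wedge_anticommute[of S2 k])

lemma nabla_cov_form: "nabla (cov_form k \<alpha>) = cov_form k (nabla \<alpha>)"
  by (simp add: nabla_eq cov_form_add cov_form_dcoord_wedge cov_form_commute[of k])

lemma nabla_X_nabla: "nabla_X (nabla \<alpha>) = - nabla (nabla_X \<alpha>)"
  by (simp add: nabla_X_eq nabla_add nabla_dcoord_wedge nabla_cov_form)

lemma nabla_scale: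
  assumes "f \<in> base_funs"
  shows "nabla (f *\<^sub>f \<alpha>) = f *\<^sub>f nabla \<alpha>"
proof -
  have "cov_form S1 (f *\<^sub>f \<alpha>) = f *\<^sub>f cov_form S1 \<alpha>" "cov_form S2 (f *\<^sub>f \<alpha>) = f *\<^sub>f cov_form S2 \<alpha>"
    using assms by (simp_all add: cov_form_scale base_funs_def) (simp_all add: fun_eq_iff scale_def)
  then show ?thesis
    by (simp add: nabla_eq wedge_scale_right scale_add)
qed

lemma nabla_one_form:
  "nabla (g *\<^sub>f ds2 - h *\<^sub>f ds1) = (cov S1 g + cov S2 h) *\<^sub>f ds12"
proof -
  have zero: "dcoord i \<and>\<^sub>f dcoord i = 0" for i
    unfolding fun_eq_iff dcoord_wedge by (auto simp: dcoord_def)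
  have swap: "ds2 \<and>\<^sub>f ds1 = - ds12"
  proof -
    have "1 *\<^sub>f \<alpha> = \<alpha>" for \<alpha>
      by (simp add: scale_def)
    then show ?thesis
      using dcoord_wedge_anticommute[of S2 S1 "zero_form 1"] by (simp only: dcoord_wedge_zero_form)
  qed
  have "nabla (g *\<^sub>f ds2 - h *\<^sub>f ds1) = nabla (g *\<^sub>f ds2) - nabla (h *\<^sub>f ds1)"
    unfolding diff_conv_add_uminus nabla_add nabla_minus ..
  moreover have "nabla (g *\<^sub>f ds2) = cov S1 g *\<^sub>f ds12"
    unfolding nabla_eq cov_form_scale_dcoord wedge_scale_right zero
    by (simp add: fun_eq_iff scale_def)
  moreover have "nabla (h *\<^sub>f ds1) = - (cov S2 h *\<^sub>f ds12)"
    unfolding nabla_eq cov_form_scale_dcoord wedge_scale_right zero swap scale_minus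
    by (simp add: fun_eq_iff scale_def)
  ultimately show ?thesis
    by (simp only: add_scale diff_minus_eq_add)
qed


section \<open>Maps on classes\<close>

lemma OmegaI:
  assumes "\<And>I. \<alpha> I \<in> regular_funs"
    and "\<And>I. \<alpha> I \<noteq> 0 \<Longrightarrow> card (I \<inter> {S1, S2}) = i \<and> card (I \<inter> {X1, X2}) = j"
  shows "\<alpha> \<in> Omega i j"
  using assms by (auto simp: Omega_def)

lemma OmegaD:
  assumes "\<alpha> \<in> Omega i j"
  shows "\<alpha> I \<in> regular_funs"
    and "\<alpha> I \<noteq> 0 \<Longrightarrow> card (I \<inter> {S1, S2}) = i \<and> card (I \<inter> {X1, X2}) = j"
  using assms by (auto simp: Omega_def)

lemma Omega_add:
  assumes "\<alpha> \<in> Omega i j" "\<beta> \<in> Omega i j"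
  shows "\<alpha> + \<beta> \<in> Omega i j"
proof (rule OmegaI)
  fix I
  show "(\<alpha> + \<beta>) I \<in> regular_funs"
    using assms by (simp add: OmegaD(1) regular_add)
  assume "(\<alpha> + \<beta>) I \<noteq> 0"
  then have "\<alpha> I \<noteq> 0 \<or> \<beta> I \<noteq> 0" by auto
  then show "card (I \<inter> {S1, S2}) = i \<and> card (I \<inter> {X1, X2}) = j"
    using assms OmegaD(2) by blast
qed

lemma Omega_minus: "\<alpha> \<in> Omega i j \<Longrightarrow> - \<alpha> \<in> Omega i j"
  by (rule OmegaI) (auto simp: OmegaD regular_minus)

lemma Omega_0: "0 \<in> Omega i j"
  by (rule OmegaI) (auto simp: regular_0)

lemma Omega_scale: "f \<in> regular_funs \<Longrightarrow> \<alpha> \<in> Omega i j \<Longrightarrow> f *\<^sub>f \<alpha> \<in> Omega i j"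
  by (rule OmegaI) (auto simp: scale_def OmegaD regular_mult)

lemma Omega_cov_form:
  assumes \<alpha>: "\<alpha> \<in> Omega i j"
  shows "cov_form k \<alpha> \<in> Omega i j"
proof (rule OmegaI)
  fix I
  show "cov_form k \<alpha> I \<in> regular_funs"
    by (simp add: cov_form_def OmegaD(1)[OF \<alpha>] regular_cov)
  assume "cov_form k \<alpha> I \<noteq> 0"
  then have "\<alpha> I \<noteq> 0" by (auto simp: cov_form_def)
  then show "card (I \<inter> {S1, S2}) = i \<and> card (I \<inter> {X1, X2}) = j"
    by (rule OmegaD(2)[OF \<alpha>])
qed

lemma Omega_dx_wedge:
  assumes "k \<in> {X1, X2}" "\<alpha> \<in> Omega i j"
  shows "dcoord k \<and>\<^sub>f \<alpha> \<in> Omega i (Suc j)"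
proof (rule OmegaI)
  fix I
  have "shuffle_sign {k} K \<in> regular_funs" for K
    unfolding shuffle_sign_def by (intro regular_intros)
  then show "(dcoord k \<and>\<^sub>f \<alpha>) I \<in> regular_funs"
    by (simp add: dcoord_wedge regular_mult regular_0 OmegaD(1)[OF assms(2)])
  assume "(dcoord k \<and>\<^sub>f \<alpha>) I \<noteq> 0"
  then have k: "k \<in> I" and "\<alpha> (I - {k}) \<noteq> 0"
    by (auto simp: dcoord_wedge split: if_splits)
  then have card: "card ((I - {k}) \<inter> {S1, S2}) = i" "card ((I - {k}) \<inter> {X1, X2}) = j"
    using OmegaD(2)[OF assms(2)] by blast+
  have "I \<inter> {S1, S2} = (I - {k}) \<inter> {S1, S2}" "I \<inter> {X1, X2} = insert k ((I - {k}) \<inter> {X1, X2})"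
    using assms(1) k by auto
  then show "card (I \<inter> {S1, S2}) = i \<and> card (I \<inter> {X1, X2}) = Suc j"
    using card by simp
qed

lemma Omega_nabla_X: "\<alpha> \<in> Omega i j \<Longrightarrow> nabla_X \<alpha> \<in> Omega i (Suc j)"
  unfolding nabla_X_eq by (intro Omega_add Omega_dx_wedge Omega_cov_form) simp_all

lemma Omega_ds: "ds1 \<in> Omega 1 0" "ds2 \<in> Omega 1 0"
  by (rule OmegaI; auto simp: dcoord_def regular_0 regular_1 split: if_splits)+

lemma cls_eqI:
  assumes "\<alpha> = \<alpha>' + nabla \<beta>" "\<beta> \<in> Omega 1 j"
  shows "cls j \<alpha> = cls j \<alpha>'"
proof
  show "cls j \<alpha> \<subseteq> cls j \<alpha>'"
  proof
    fix \<gamma> assume "\<gamma> \<in> cls j \<alpha>"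
    then obtain \<beta>' where \<beta>': "\<gamma> = \<alpha> + nabla \<beta>'" "\<beta>' \<in> Omega 1 j"
      unfolding cls_def by blast
    then have "\<gamma> = \<alpha>' + nabla (\<beta> + \<beta>')"
      by (simp add: assms(1) nabla_add add.assoc)
    then show "\<gamma> \<in> cls j \<alpha>'"
      using Omega_add[OF assms(2) \<beta>'(2)] unfolding cls_def by blast
  qed
  show "cls j \<alpha>' \<subseteq> cls j \<alpha>"
  proof
    fix \<gamma> assume "\<gamma> \<in> cls j \<alpha>'"
    then obtain \<beta>' where \<beta>': "\<gamma> = \<alpha>' + nabla \<beta>'" "\<beta>' \<in> Omega 1 j"
      unfolding cls_def by blast
    then have "\<gamma> = \<alpha> + nabla (\<beta>' + - \<beta>)"
      by (simp only: assms(1) nabla_add nabla_minus) simp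
    then show "\<gamma> \<in> cls j \<alpha>"
      using Omega_add[OF \<beta>'(2) Omega_minus[OF assms(2)]] unfolding cls_def by blast
  qed
qed

lemma cls_self: "\<alpha> \<in> cls j \<alpha>"
  unfolding cls_def using Omega_0 nabla_0 by force

lemma cls_add: "cls j \<alpha> + cls j \<beta> = cls j (\<alpha> + \<beta>)"
proof
  show "cls j \<alpha> + cls j \<beta> \<subseteq> cls j (\<alpha> + \<beta>)"
  proof
    fix \<gamma> assume "\<gamma> \<in> cls j \<alpha> + cls j \<beta>"
    then obtain \<beta>1 \<beta>2 where "\<gamma> = (\<alpha> + nabla \<beta>1) + (\<beta> + nabla \<beta>2)"
      "\<beta>1 \<in> Omega 1 j" "\<beta>2 \<in> Omega 1 j"
      unfolding cls_def set_plus_def by blast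
    then have "\<gamma> = \<alpha> + \<beta> + nabla (\<beta>1 + \<beta>2)" "\<beta>1 + \<beta>2 \<in> Omega 1 j"
      by (simp_all add: nabla_add add_ac Omega_add)
    then show "\<gamma> \<in> cls j (\<alpha> + \<beta>)" unfolding cls_def by blast
  qed
  show "cls j (\<alpha> + \<beta>) \<subseteq> cls j \<alpha> + cls j \<beta>"
  proof
    fix \<gamma> assume "\<gamma> \<in> cls j (\<alpha> + \<beta>)"
    then obtain \<beta>' where \<beta>': "\<gamma> = (\<alpha> + \<beta>) + nabla \<beta>'" "\<beta>' \<in> Omega 1 j"
      unfolding cls_def by blast
    then have "\<gamma> = (\<alpha> + nabla \<beta>') + \<beta>"
      by (simp only: add_ac)
    moreover have "\<alpha> + nabla \<beta>' \<in> cls j \<alpha>"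
      using \<beta>'(2) unfolding cls_def by blast
    ultimately show "\<gamma> \<in> cls j \<alpha> + cls j \<beta>"
      by (simp add: cls_self set_plus_intro)
  qed
qed

lemma sum_cls: "(\<Sum>k\<le>n. cls j (\<alpha> k)) = cls j (\<Sum>k\<le>(n::nat). \<alpha> k)"
proof (induction n)
  case (Suc n)
  then show ?case by (simp only: sum.atMost_Suc cls_add)
qed simp

lemma nabla_X_cls: "nabla_X_cls (cls 0 \<alpha>) = cls 1 (nabla_X \<alpha>)"
proof -
  have "cls 1 (nabla_X \<gamma>) = cls 1 (nabla_X \<alpha>)" if "\<gamma> \<in> cls 0 \<alpha>" for \<gamma>
  proof -
    from that obtain \<beta> where \<beta>: "\<gamma> = \<alpha> + nabla \<beta>" "\<beta> \<in> Omega 1 0"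
      by (auto simp: cls_def)
    show ?thesis
    proof (rule cls_eqI)
      show "nabla_X \<gamma> = nabla_X \<alpha> + nabla (- nabla_X \<beta>)"
        by (simp add: \<beta> nabla_X_add nabla_X_nabla nabla_minus)
      show "- nabla_X \<beta> \<in> Omega 1 1"
        using \<beta>(2) Omega_nabla_X[of \<beta> 1 0] by (simp add: Omega_minus)
    qed
  qed
  then show ?thesis
    unfolding nabla_X_cls_def using cls_self by blast
qed

lemma wedge_cls:
  assumes \<theta>: "\<theta> = a *\<^sub>f dx1 + b *\<^sub>f dx2"
    and base: "a \<in> base_funs" "b \<in> base_funs"
  shows "wedge_cls \<theta> (cls 0 \<alpha>) = cls 1 (\<theta> \<and>\<^sub>f \<alpha>)"
proof -
  have wedge: "\<theta> \<and>\<^sub>f \<beta> = a *\<^sub>f (dx1 \<and>\<^sub>f \<beta>) + b *\<^sub>f (dx2 \<and>\<^sub>f \<beta>)" for \<beta>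
    by (simp add: \<theta> wedge_add_left wedge_scale_left)
  have reg: "a \<in> regular_funs" "b \<in> regular_funs"
    using base by (simp_all add: base_funs_def)
  have "cls 1 (\<theta> \<and>\<^sub>f \<gamma>) = cls 1 (\<theta> \<and>\<^sub>f \<alpha>)" if "\<gamma> \<in> cls 0 \<alpha>" for \<gamma>
  proof -
    from that obtain \<beta> where \<beta>: "\<gamma> = \<alpha> + nabla \<beta>" "\<beta> \<in> Omega 1 0"
      by (auto simp: cls_def)
    show ?thesis
    proof (rule cls_eqI)
      show "\<theta> \<and>\<^sub>f \<gamma> = \<theta> \<and>\<^sub>f \<alpha> + nabla (- (\<theta> \<and>\<^sub>f \<beta>))"
        unfolding \<beta>(1) wedge wedge_add_right scale_add nabla_minus nabla_add
          nabla_scale[OF base(1)] nabla_scale[OF base(2)] nabla_dcoord_wedge scale_minus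
        by (simp add: add_ac)
      show "- (\<theta> \<and>\<^sub>f \<beta>) \<in> Omega 1 1"
        unfolding wedge using \<beta>(2) Omega_dx_wedge[of _ \<beta> 1 0]
        by (intro Omega_minus Omega_add Omega_scale reg) simp_all
    qed
  qed
  then show ?thesis
    unfolding wedge_cls_def using cls_self by blast
qed

text \<open>
  The relation on coefficients \<open>f\<close> that corresponds to equality of the classes of \<open>f ds\<^sub>1\<^sub>2\<close>.
\<close>

definition divergence_equiv :: "ratfun \<Rightarrow> ratfun \<Rightarrow> bool"  (infix "\<approx>" 50) where
  "f \<approx> f' \<longleftrightarrow> (\<exists>g\<in>regular_funs. \<exists>h\<in>regular_funs. f = f' + (cov S1 g + cov S2 h))"

lemma divergence_equivI:
  "f = f' + cov S1 g + cov S2 h \<Longrightarrow> g \<in> regular_funs \<Longrightarrow> h \<in> regular_funs \<Longrightarrow> f \<approx> f'"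
  "f = f' + cov S2 h + cov S1 g \<Longrightarrow> g \<in> regular_funs \<Longrightarrow> h \<in> regular_funs \<Longrightarrow> f \<approx> f'"
  "f = f' + cov S1 g \<Longrightarrow> g \<in> regular_funs \<Longrightarrow> f \<approx> f'"
  "f = f' + cov S2 g \<Longrightarrow> g \<in> regular_funs \<Longrightarrow> f \<approx> f'"
  "f = f' \<Longrightarrow> f \<approx> f'"
  unfolding divergence_equiv_def
      apply (metis add.assoc)
     apply (metis add.assoc add.commute)
    apply (metis add_0_right cov_0 regular_0)
   apply (metis add_0_left cov_0 regular_0)
  apply (metis add_0_right cov_0 regular_0)
  done

text \<open>
  The translation from classes to functions: since \<open>\<nabla>(g ds\<^sub>2 - h ds\<^sub>1) = (D\<^sub>s\<^sub>1 g + D\<^sub>s\<^sub>2 h) ds\<^sub>1\<^sub>2\<close>,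
  an identity of classes of forms \<open>f ds\<^sub>1\<^sub>2\<close> holds as soon as one of functions does up to such
  divergences, separately for the coefficients of \<open>dx\<^sub>1\<close> and \<open>dx\<^sub>2\<close>.
\<close>

lemma nabla_X_cls_eq_wedge_sum:
  fixes n :: nat
  assumes \<theta>: "\<And>j. j \<le> n \<Longrightarrow> \<theta> j = a j *\<^sub>f dx1 + b j *\<^sub>f dx2"
    and base: "\<And>j. j \<le> n \<Longrightarrow> a j \<in> base_funs" "\<And>j. j \<le> n \<Longrightarrow> b j \<in> base_funs"
    and equiv: "cov X1 f \<approx> (\<Sum>j\<le>n. a j * F j)" "cov X2 f \<approx> (\<Sum>j\<le>n. b j * F j)"
  shows "nabla_X_cls (cls 0 (f *\<^sub>f ds12)) = (\<Sum>j\<le>n. wedge_cls (\<theta> j) (cls 0 (F j *\<^sub>f ds12)))"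
proof -
  obtain g1 h1 g2 h2 where
    regular: "g1 \<in> regular_funs" "h1 \<in> regular_funs" "g2 \<in> regular_funs" "h2 \<in> regular_funs"
    and eq1: "cov X1 f = (\<Sum>j\<le>n. a j * F j) + (cov S1 g1 + cov S2 h1)"
    and eq2: "cov X2 f = (\<Sum>j\<le>n. b j * F j) + (cov S1 g2 + cov S2 h2)"
    using equiv unfolding divergence_equiv_def by blast
  let ?\<beta> = "\<lambda>g h. g *\<^sub>f ds2 - h *\<^sub>f ds1"
  have sum: "(\<Sum>j\<le>n. \<theta> j \<and>\<^sub>f (F j *\<^sub>f ds12))
    = (\<Sum>j\<le>n. a j * F j) *\<^sub>f (dx1 \<and>\<^sub>f ds12) + (\<Sum>j\<le>n. b j * F j) *\<^sub>f (dx2 \<and>\<^sub>f ds12)"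
  proof -
    have "(\<Sum>j\<le>n. \<theta> j \<and>\<^sub>f (F j *\<^sub>f ds12))
      = (\<Sum>j\<le>n. (a j * F j) *\<^sub>f (dx1 \<and>\<^sub>f ds12) + (b j * F j) *\<^sub>f (dx2 \<and>\<^sub>f ds12))"
      by (intro sum.cong) (simp_all add: \<theta> wedge_add_left wedge_scale_left wedge_scale_right
          scale_scale scale_add mult.commute)
    moreover have "(\<Sum>j\<le>n. c j) *\<^sub>f \<alpha> = (\<Sum>j\<le>n. c j *\<^sub>f \<alpha>)" for c \<alpha>
    proof (induction n)
      case (Suc n)
      then show ?case by (simp only: sum.atMost_Suc add_scale)
    qed simp
    ultimately show ?thesis
      by (simp only: sum.distrib)
  qed
  have "nabla_X (f *\<^sub>f ds12) = cov X1 f *\<^sub>f (dx1 \<and>\<^sub>f ds12) + cov X2 f *\<^sub>f (dx2 \<and>\<^sub>f ds12)"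
    unfolding nabla_X_eq cov_form_scale_ds12 wedge_scale_right ..
  moreover have "nabla (- (dx1 \<and>\<^sub>f ?\<beta> g1 h1 + dx2 \<and>\<^sub>f ?\<beta> g2 h2)) =
      (cov S1 g1 + cov S2 h1) *\<^sub>f (dx1 \<and>\<^sub>f ds12) + (cov S1 g2 + cov S2 h2) *\<^sub>f (dx2 \<and>\<^sub>f ds12)"
    unfolding nabla_minus nabla_add nabla_dcoord_wedge nabla_one_form wedge_scale_right
    by (simp only: minus_add_distrib minus_minus)
  ultimately have "nabla_X (f *\<^sub>f ds12) = (\<Sum>j\<le>n. \<theta> j \<and>\<^sub>f (F j *\<^sub>f ds12))
      + nabla (- (dx1 \<and>\<^sub>f ?\<beta> g1 h1 + dx2 \<and>\<^sub>f ?\<beta> g2 h2))"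
    unfolding sum eq1 eq2 by (simp only: add_scale add_ac)
  moreover have "- (dx1 \<and>\<^sub>f ?\<beta> g1 h1 + dx2 \<and>\<^sub>f ?\<beta> g2 h2) \<in> Omega 1 (Suc 0)"
    unfolding diff_conv_add_uminus
    by (intro Omega_minus Omega_add Omega_dx_wedge Omega_scale Omega_ds regular) simp_all
  then have "- (dx1 \<and>\<^sub>f ?\<beta> g1 h1 + dx2 \<and>\<^sub>f ?\<beta> g2 h2) \<in> Omega 1 1"
    by (simp only: One_nat_def)
  ultimately have
    "nabla_X_cls (cls 0 (f *\<^sub>f ds12)) = cls 1 (\<Sum>j\<le>n. \<theta> j \<and>\<^sub>f (F j *\<^sub>f ds12))"
    unfolding nabla_X_cls by (rule cls_eqI)
  also have "\<dots> = (\<Sum>j\<le>n. cls 1 (\<theta> j \<and>\<^sub>f (F j *\<^sub>f ds12)))"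
    by (rule sum_cls[symmetric])
  also have "\<dots> = (\<Sum>j\<le>n. wedge_cls (\<theta> j) (cls 0 (F j *\<^sub>f ds12)))"
    by (intro sum.cong refl wedge_cls[symmetric, OF \<theta> base]) simp_all
  finally show ?thesis .
qed


section \<open>Reduction of the derivatives in one direction\<close>

text \<open>
  The computation for one of the two directions, with \<open>(s, t, x, y)\<close> standing for
  \<open>(s\<^sub>1, s\<^sub>2, x\<^sub>1, x\<^sub>2)\<close> when differentiating by \<open>x\<^sub>1\<close>, and for \<open>(s\<^sub>2, s\<^sub>1, x\<^sub>2, x\<^sub>1)\<close> when differentiating
  by \<open>x\<^sub>2\<close>.
\<close>

locale appell_direction =
  fixes Ds Dt Dx :: "'a::field \<Rightarrow> 'a"
    and s t x y l1 l2 l3 l4 Q L R :: 'a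
  assumes derivations: "is_derivation Ds" "is_derivation Dt" "is_derivation Dx"
    and coordinates [simp]:
      "Ds s = 1" "Ds t = 0" "Ds x = 0" "Ds y = 0"
      "Dt s = 0" "Dt t = 1" "Dt x = 0" "Dt y = 0"
      "Dx s = 0" "Dx t = 0" "Dx x = 1" "Dx y = 0"
    and parameters [simp]:
      "Ds l1 = 0" "Ds l2 = 0" "Ds l3 = 0" "Ds l4 = 0"
      "Dt l1 = 0" "Dt l2 = 0" "Dt l3 = 0" "Dt l4 = 0"
    and Q_eq: "Q = s * t - s - t"
    and L_eq: "L = 1 - s * x - t * y"
    and R_eq: "R = x\<^sup>2 + y\<^sup>2 - 2 * x * y - 2 * x - 2 * y + 1"
    and nonzero [simp]:
      "s \<noteq> 0" "t \<noteq> 0" "x \<noteq> 0" "Q \<noteq> 0" "L \<noteq> 0" "R \<noteq> 0" "l3 \<noteq> 0" "2 \<noteq> (0::'a)"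
begin

lemmas Ds_rules = derivations(1)[THEN derivation_add] derivations(1)[THEN derivation_mult]
  derivations(1)[THEN derivation_0] derivations(1)[THEN derivation_1]
  derivations(1)[THEN derivation_minus] derivations(1)[THEN derivation_diff]
  derivations(1)[THEN derivation_numeral] derivations(1)[THEN derivation_divide]

lemmas Dt_rules = derivations(2)[THEN derivation_add] derivations(2)[THEN derivation_mult]
  derivations(2)[THEN derivation_0] derivations(2)[THEN derivation_1]
  derivations(2)[THEN derivation_minus] derivations(2)[THEN derivation_diff]
  derivations(2)[THEN derivation_numeral] derivations(2)[THEN derivation_divide]

lemmas Dx_rules = derivations(3)[THEN derivation_add] derivations(3)[THEN derivation_mult]
  derivations(3)[THEN derivation_0] derivations(3)[THEN derivation_1]
  derivations(3)[THEN derivation_minus] derivations(3)[THEN derivation_diff]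
  derivations(3)[THEN derivation_numeral] derivations(3)[THEN derivation_divide]

lemma derivatives_Q_L_R [simp]:
  "Ds Q = t - 1" "Dt Q = s - 1" "Dx Q = 0" "Ds L = - x" "Dt L = - y" "Dx L = - s"
  "Ds R = 0" "Dt R = 0"
  by (simp_all add: Q_eq L_eq R_eq power2_eq_square Ds_rules Dt_rules Dx_rules)

definition cov_s :: "'a \<Rightarrow> 'a" where
  "cov_s f = Ds f + (l1 / s + l3 * (t - 1) / Q - l4 * x / L) * f"

definition cov_t :: "'a \<Rightarrow> 'a" where
  "cov_t f = Dt f + (l2 / t + l3 * (s - 1) / Q - l4 * y / L) * f"

definition cov_x :: "'a \<Rightarrow> 'a" where
  "cov_x f = Dx f - l4 * s / L * f"

lemma cov_s_add: "cov_s (f + g) = cov_s f + cov_s g"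
  and cov_t_add: "cov_t (f + g) = cov_t f + cov_t g"
  by (simp_all add: cov_s_def cov_t_def Ds_rules Dt_rules distrib_left add_ac)

lemma cov_s_mult: "cov_s (f * g) = Ds f * g + f * cov_s g"
  and cov_t_mult: "cov_t (f * g) = Dt f * g + f * cov_t g"
  by (simp_all add: cov_s_def cov_t_def Ds_rules Dt_rules algebra_simps)

text \<open>
  The next three lemmas compute the twisted divergences of \<open>\<beta> s Q \<partial>\<^sub>s\<close>, \<open>\<gamma> t Q \<partial>\<^sub>t\<close> and
  \<open>\<alpha> (t\<^sup>2 \<partial>\<^sub>t - s\<^sup>2 \<partial>\<^sub>s)\<close>, each divided by \<open>s t Q L\<close>. There is no pole of order two along \<open>Q = 0\<close>,
  since the three fields map \<open>Q\<close> to \<open>s Q (t - 1)\<close>, \<open>t Q (s - 1)\<close> and \<open>(t - s) Q\<close>, multiples of \<open>Q\<close>.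
\<close>

lemma cov_s_field:
  "cov_s (\<beta> / (t * L)) = (s * Q * L * Ds \<beta>
     + \<beta> * (((l1 + l3) * Q + l3 * t) * L + (1 - l4) * x * s * Q)) / (s * t * Q * L\<^sup>2)"
proof -
  have "l1 / s + l3 * (t - 1) / Q - l4 * x / L
      = (((l1 + l3) * Q + l3 * t) * L - l4 * x * s * Q) / (s * Q * L)"
    by (simp add: divide_simps) (simp add: Q_eq algebra_simps)
  then show ?thesis
    unfolding cov_s_def
    by (simp add: Ds_rules divide_simps) (simp add: power2_eq_square algebra_simps)
qed

lemma cov_t_field:
  "cov_t (\<gamma> / (s * L)) = (t * Q * L * Dt \<gamma>
     + \<gamma> * (((l2 + l3) * Q + l3 * s) * L + (1 - l4) * y * t * Q)) / (s * t * Q * L\<^sup>2)"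
proof -
  have "l2 / t + l3 * (s - 1) / Q - l4 * y / L
      = (((l2 + l3) * Q + l3 * s) * L - l4 * y * t * Q) / (t * Q * L)"
    by (simp add: divide_simps) (simp add: Q_eq algebra_simps)
  then show ?thesis
    unfolding cov_t_def
    by (simp add: Dt_rules divide_simps) (simp add: power2_eq_square algebra_simps)
qed

lemma cov_mixed_field:
  "cov_s (- (s * \<alpha>) / (t * Q * L)) + cov_t (t * \<alpha> / (s * Q * L)) =
   (L * (t\<^sup>2 * Dt \<alpha> - s\<^sup>2 * Ds \<alpha> + \<alpha> * ((l2 + l3) * t - (l1 + l3) * s))
     - (1 - l4) * \<alpha> * (x * s\<^sup>2 - y * t\<^sup>2)) / (s * t * Q * L\<^sup>2)"
proof -
  let ?u = "- (s\<^sup>2 * Ds \<alpha>) * Q * L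
    - \<alpha> * s * ((1 + l1) * Q * L - (1 - l3) * s * (t - 1) * L + (1 - l4) * x * s * Q)"
  let ?v = "t\<^sup>2 * Dt \<alpha> * Q * L
    + \<alpha> * t * ((1 + l2) * Q * L - (1 - l3) * t * (s - 1) * L + (1 - l4) * y * t * Q)"
  have es: "cov_s (- (s * \<alpha>) / (t * Q * L)) = ?u / (s * t * Q\<^sup>2 * L\<^sup>2)"
    unfolding cov_s_def
    by (simp add: Ds_rules divide_simps) (simp add: power2_eq_square algebra_simps)
  have et: "cov_t (t * \<alpha> / (s * Q * L)) = ?v / (s * t * Q\<^sup>2 * L\<^sup>2)"
    unfolding cov_t_def
    by (simp add: Dt_rules divide_simps) (simp add: power2_eq_square algebra_simps)
  have "s * (t - 1) = Q + t" "t * (s - 1) = Q + s"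
    by (simp_all add: Q_eq algebra_simps)
  then have "?u + ?v
     = Q * (L * (t\<^sup>2 * Dt \<alpha> - s\<^sup>2 * Ds \<alpha> + \<alpha> * ((l2 + l3) * t - (l1 + l3) * s))
     - (1 - l4) * \<alpha> * (x * s\<^sup>2 - y * t\<^sup>2))"
    by algebra
  moreover have "s * t * Q\<^sup>2 * L\<^sup>2 = Q * (s * t * Q * L\<^sup>2)"
    by (simp add: power2_eq_square)
  ultimately show ?thesis
    unfolding es et add_divide_distrib[symmetric]
    by (simp only: mult_divide_mult_cancel_left[OF nonzero(4)])
qed

text \<open>
  The components of the vector field with coefficients \<open>\<alpha>, \<beta>, \<gamma>\<close>, divided by \<open>s t Q L\<close> and by a
  common denominator \<open>K\<close>.
\<close>

definition field_s :: "'a \<Rightarrow> 'a \<Rightarrow> 'a \<Rightarrow> 'a" where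
  "field_s K \<alpha> \<beta> = 1 / K * (\<beta> / (t * L) - s * \<alpha> / (t * Q * L))"

definition field_t :: "'a \<Rightarrow> 'a \<Rightarrow> 'a \<Rightarrow> 'a" where
  "field_t K \<alpha> \<gamma> = 1 / K * (\<gamma> / (s * L) + t * \<alpha> / (s * Q * L))"

text \<open>
  Clearing the denominator \<open>s t Q L\<^sup>2\<close> reduces a row of \<open>\<Xi>\<close>, with entries \<open>e\<^sub>j / K\<close>, to an identity
  between polynomials in \<open>s, t\<close>.
\<close>

lemma reduction:
  assumes K: "K \<noteq> 0" "Ds K = 0" "Dt K = 0"
    and N: "K * N = e1 * (Q * L\<^sup>2) + e2 * (x * s * Q * L) + e3 * (y * t * Q * L) + e4 * (s * t * L)
      + (s * Q * L * Ds \<beta> + \<beta> * (((l1 + l3) * Q + l3 * t) * L + (1 - l4) * x * s * Q))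
      + (t * Q * L * Dt \<gamma> + \<gamma> * (((l2 + l3) * Q + l3 * s) * L + (1 - l4) * y * t * Q))
      + (L * (t\<^sup>2 * Dt \<alpha> - s\<^sup>2 * Ds \<alpha> + \<alpha> * ((l2 + l3) * t - (l1 + l3) * s))
          - (1 - l4) * \<alpha> * (x * s\<^sup>2 - y * t\<^sup>2))"
  shows "N / (s * t * Q * L\<^sup>2) =
    e1 / K * (1 / (s * t)) + e2 / K * (x / (t * L)) + e3 / K * (y / (s * L)) + e4 / K * (1 / (Q * L))
    + cov_s (field_s K \<alpha> \<beta>) + cov_t (field_t K \<alpha> \<gamma>)"
proof -
  have k: "Ds (1 / K) = 0" "Dt (1 / K) = 0"
    using K by (simp_all add: Ds_rules Dt_rules)
  define E where "E = e1 * (Q * L\<^sup>2) + e2 * (x * s * Q * L) + e3 * (y * t * Q * L)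
    + e4 * (s * t * L)"
  define B where "B = s * Q * L * Ds \<beta>
    + \<beta> * (((l1 + l3) * Q + l3 * t) * L + (1 - l4) * x * s * Q)"
  define C where "C = t * Q * L * Dt \<gamma>
    + \<gamma> * (((l2 + l3) * Q + l3 * s) * L + (1 - l4) * y * t * Q)"
  define A where "A = L * (t\<^sup>2 * Dt \<alpha> - s\<^sup>2 * Ds \<alpha> + \<alpha> * ((l2 + l3) * t - (l1 + l3) * s))
    - (1 - l4) * \<alpha> * (x * s\<^sup>2 - y * t\<^sup>2)"
  have "cov_s (field_s K \<alpha> \<beta>) + cov_t (field_t K \<alpha> \<gamma>)
      = 1 / K * (cov_s (\<beta> / (t * L) + - (s * \<alpha>) / (t * Q * L))
        + cov_t (\<gamma> / (s * L) + t * \<alpha> / (s * Q * L)))"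
    unfolding field_s_def field_t_def cov_s_mult cov_t_mult k by (simp add: distrib_left)
  also have "\<dots> = 1 / K * (cov_s (\<beta> / (t * L)) + cov_t (\<gamma> / (s * L))
      + (cov_s (- (s * \<alpha>) / (t * Q * L)) + cov_t (t * \<alpha> / (s * Q * L))))"
    unfolding cov_s_add cov_t_add by (simp only: add_ac)
  also have "\<dots> = 1 / K * ((B + C + A) / (s * t * Q * L\<^sup>2))"
    unfolding cov_s_field cov_t_field cov_mixed_field A_def B_def C_def
    by (simp only: add_divide_distrib)
  finally have divergence: "cov_s (field_s K \<alpha> \<beta>) + cov_t (field_t K \<alpha> \<gamma>)
    = 1 / K * ((B + C + A) / (s * t * Q * L\<^sup>2))" .
  have basis: "e1 / K * (1 / (s * t)) + e2 / K * (x / (t * L)) + e3 / K * (y / (s * L))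
      + e4 / K * (1 / (Q * L)) = 1 / K * (E / (s * t * Q * L\<^sup>2))"
    unfolding E_def using K(1)
    by (simp add: divide_simps) (simp add: algebra_simps power2_eq_square)
  have "N / (s * t * Q * L\<^sup>2) = 1 / K * (K * N / (s * t * Q * L\<^sup>2))"
    using K(1) by simp
  also have "K * N = E + (B + C + A)"
    using N unfolding A_def B_def C_def E_def by (simp only: add_ac)
  finally show ?thesis
    using basis divergence by (simp only: add_divide_distrib distrib_left add.assoc)
qed

lemma cov_x_phi1: "cov_x (1 / (s * t)) = - (l4 / x) * (x / (t * L))"
  unfolding cov_x_def by (simp add: Dx_rules divide_simps)

lemma cov_x_phi2:
  "cov_x (x / (t * L)) =
    - (l1 + l3) / x * (x / (t * L)) + - l3 * (1 / (Q * L)) + cov_s (s / (t * L))"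
proof -
  have "cov_x (x / (t * L)) = 1 / (t * L) + (1 - l4) * (s * x) / (t * L\<^sup>2)"
    unfolding cov_x_def
    by (simp add: Dx_rules divide_simps) (simp add: power2_eq_square algebra_simps)
  also have "\<dots> = - (l1 + l3) / x * (x / (t * L)) + - l3 * (1 / (Q * L)) + cov_s (s / (t * L))"
    unfolding cov_s_field
    apply (simp add: Ds_rules divide_simps)
    unfolding Q_eq L_eq by algebra
  finally show ?thesis .
qed

text \<open>
  Here the double pole along \<open>L = 0\<close> is removed by \<open>\<beta> = 1 - x s\<close> and \<open>\<gamma> = 1 - y t\<close>, which on
  that line equal \<open>y t\<close> and \<open>x s\<close>: the terms \<open>x s \<beta>\<close> and \<open>y t \<gamma>\<close> add up to \<open>2 x y s t\<close> there.
\<close>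

lemma cov_x_phi3:
  "cov_x (y / (s * L)) =
   - (l1 + l2 + l3) / (2 * x) * (1 / (s * t)) + - (l2 - l4) / (2 * x) * (x / (t * L))
   + - (l1 - l4) / (2 * x) * (y / (s * L)) + - (l3 * (1 - x - y)) / (2 * x) * (1 / (Q * L))
   + cov_s (field_s (2 * x) 0 (1 - x * s)) + cov_t (field_t (2 * x) 0 (1 - y * t))"
    (is "_ = ?r")
proof -
  have "cov_x (y / (s * L)) = (1 - l4) * y / L\<^sup>2"
    unfolding cov_x_def
    by (simp add: Dx_rules divide_simps) (simp add: power2_eq_square algebra_simps)
  also have "\<dots> = (1 - l4) * y * s * t * Q / (s * t * Q * L\<^sup>2)"
    by (simp add: divide_simps)
  also have "\<dots> = ?r"
    apply (rule reduction)
       apply (simp_all add: Ds_rules Dt_rules)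
    unfolding Q_eq L_eq by algebra
  finally show ?thesis .
qed

text \<open>
  Comparing double poles along \<open>L = 0\<close> gives
  \<open>K s\<^sup>2 t \<equiv> Q (x s \<beta> + y t \<gamma>) - \<alpha> (x s\<^sup>2 - y t\<^sup>2)\<close> modulo \<open>L\<close>. At the two points where \<open>Q = L = 0\<close>
  this prescribes \<open>\<alpha>\<close>, so that \<open>\<alpha>\<close> on the line \<open>L = 0\<close> is found by linear interpolation. The points
  collide exactly when the line is tangent to the conic \<open>Q = 0\<close>, that is when \<open>R = 0\<close>; this is how \<open>R\<close>
  enters the denominator \<open>K\<close>. The remaining coefficients of \<open>\<beta>\<close> and \<open>\<gamma>\<close>, of degree at most one in
  \<open>s, t\<close>, are then fixed by linear equations, up to adding to the vector field a multiple of the one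
  that belongs to \<open>\<omega>\<close>, whose twisted divergence vanishes. The choice below is the one in which \<open>\<alpha>\<close> has
  no term in \<open>s\<close>.
\<close>

lemma cov_x_phi4:
  defines "q \<equiv> 1 - x - y" and "w \<equiv> 1 + x - y" and "K \<equiv> 2 * x * l3 * R"
    and "M \<equiv> l1 * l2 + l1 * l4 + l2 * l4 + 2 * l3 * l4 + l4\<^sup>2"
  defines "\<alpha> \<equiv> - 2 * l3 * q + 2 * l3 * y * w * t"
    and "\<beta> \<equiv> l4 * w + (4 * l3 + 2 * l2) * (1 - y) + l1 * q
       - x * (l4 * w + 2 * l3 * w + 2 * l2 * (1 - y) + l1 * q) * s - 2 * y * w * (l2 + l3 + l4) * t"
    and "\<gamma> \<equiv> l4 * w + 4 * l3 * x + 2 * l2 * x - l1 * q - y * (l4 * w + 2 * l2 * x - l1 * q) * t"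
  shows "cov_x (1 / (Q * L)) =
   (l1 + l2 + l3) * (2 * x * (l1 - l2) - (l1 + 2 * l3 + l4) * w) / K * (1 / (s * t))
   + (- 2 * x * (l2 - l4) * (l2 + 2 * l3 + l4) + M * q) / K * (x / (t * L))
   + (2 * x * M - (l1 - l4) * (l1 + l4 + 2 * l3) * q) / K * (y / (s * L))
   + l3 * (- (l1 - 2 * l3 - 3 * l4 + 2) * x\<^sup>2 + (l1 - l4 + 1) * 2 * x * (1 + y)
       - (l1 + 2 * l3 + l4) * (y - 1)\<^sup>2) / K * (1 / (Q * L))
   + cov_s (field_s K \<alpha> \<beta>) + cov_t (field_t K \<alpha> \<gamma>)"
    (is "_ = ?r")
proof -
  have "cov_x (1 / (Q * L)) = (1 - l4) * s / (Q * L\<^sup>2)"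
    unfolding cov_x_def
    by (simp add: Dx_rules divide_simps) (simp add: power2_eq_square algebra_simps)
  also have "\<dots> = (1 - l4) * s\<^sup>2 * t / (s * t * Q * L\<^sup>2)"
    by (simp add: divide_simps power2_eq_square)
  also have "\<dots> = ?r"
  proof (rule reduction, goal_cases)
    case 1
    then show ?case by (simp add: K_def)
  next
    case 2
    then show ?case by (simp add: K_def Ds_rules)
  next
    case 3
    then show ?case by (simp add: K_def Dt_rules)
  next
    case 4
    then show ?case
      unfolding q_def w_def K_def M_def \<alpha>_def \<beta>_def \<gamma>_def
      apply (simp add: Ds_rules Dt_rules)
      unfolding Q_eq L_eq R_eq by algebra
  qed
  finally show ?thesis .
qed

end


section \<open>The connection matrix\<close>

interpretation dir1: appell_direction "partial S1" "partial S2" "partial X1"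
  s1 s2 x1 x2 lam1 lam2 lam3 lam4 QQ LL RR
  by unfold_locales
    (simp_all add: is_derivation_partial nonzero_divisors lam3_neq_zero two_neq_zero,
      simp_all add: QQ_def LL_def RR_def)

interpretation dir2: appell_direction "partial S2" "partial S1" "partial X2"
  s2 s1 x2 x1 lam2 lam1 lam3 lam4 QQ LL RR
  by unfold_locales
    (simp_all add: is_derivation_partial nonzero_divisors lam3_neq_zero two_neq_zero,
      simp_all add: QQ_def LL_def RR_def algebra_simps)

lemma cov_dir:
  "dir1.cov_s = cov S1" "dir1.cov_t = cov S2" "dir1.cov_x = cov X1"
  "dir2.cov_s = cov S2" "dir2.cov_t = cov S1" "dir2.cov_x = cov X2"
  unfolding fun_eq_iff dir1.cov_s_def dir1.cov_t_def dir1.cov_x_def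
    dir2.cov_s_def dir2.cov_t_def dir2.cov_x_def cov_def conn_eq
  by (simp_all add: add_ac)

lemma regular_fields:
  assumes "inverse K \<in> regular_funs" "\<alpha> \<in> regular_funs" "\<beta> \<in> regular_funs"
  shows "dir1.field_s K \<alpha> \<beta> \<in> regular_funs" "dir1.field_t K \<alpha> \<beta> \<in> regular_funs"
    "dir2.field_s K \<alpha> \<beta> \<in> regular_funs" "dir2.field_t K \<alpha> \<beta> \<in> regular_funs"
  unfolding dir1.field_s_def dir1.field_t_def dir2.field_s_def dir2.field_t_def using assms
  by (intro regular_intros; simp)+

definition phi_coeff :: "ratfun list" where
  "phi_coeff = [1 / (s1 * s2), x1 / (s2 * LL), x2 / (s1 * LL), 1 / (QQ * LL)]"

lemma less_4_cases:
  fixes i :: nat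
  assumes "i < 4"
  obtains "i = 0" | "i = 1" | "i = 2" | "i = 3"
  using assms by linarith

lemma phi_eq: "i < 4 \<Longrightarrow> phi ! i = (phi_coeff ! i) *\<^sub>f ds12"
  by (erule less_4_cases) (simp_all add: phi_def phi_coeff_def)

lemma base_Xi:
  assumes "i < 4" "j < 4"
  shows "Xi1 ! i ! j \<in> base_funs" "Xi2 ! i ! j \<in> base_funs"
proof -
  note intros = base_intros base_divide regular_inverse_mult regular_inverse_divisors
    regular_inverse_lam3 regular_inverse_2
  have "Xi1_41 \<in> base_funs" "Xi1_42 \<in> base_funs" "Xi1_43 \<in> base_funs" "Xi1_44 \<in> base_funs"
    "Xi2_41 \<in> base_funs" "Xi2_42 \<in> base_funs" "Xi2_43 \<in> base_funs" "Xi2_44 \<in> base_funs"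
    unfolding Xi1_41_def Xi1_42_def Xi1_43_def Xi1_44_def
      Xi2_41_def Xi2_42_def Xi2_43_def Xi2_44_def power2_eq_square
    by (intro intros)+
  then have "\<forall>r\<in>set Xi1. \<forall>f\<in>set r. f \<in> base_funs" "\<forall>r\<in>set Xi2. \<forall>f\<in>set r. f \<in> base_funs"
    unfolding Xi1_def Xi2_def by (auto intro!: intros)
  moreover have "Xi1 ! i \<in> set Xi1" "Xi2 ! i \<in> set Xi2"
    by (rule nth_mem; use assms in \<open>simp add: Xi1_def Xi2_def\<close>)+
  moreover have "\<forall>r\<in>set Xi1. length r = 4" "\<forall>r\<in>set Xi2. length r = 4"
    by (simp_all add: Xi1_def Xi2_def)
  ultimately show "Xi1 ! i ! j \<in> base_funs" "Xi2 ! i ! j \<in> base_funs"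
    using assms(2) by simp_all
qed

lemma Xi1_row4:
  "Xi1_41 = (lam1 + lam2 + lam3) * (2 * x1 * (lam1 - lam2)
     - (lam1 + 2 * lam3 + lam4) * (1 + x1 - x2)) / (2 * x1 * lam3 * RR)"
  "Xi1_42 = (- 2 * x1 * (lam2 - lam4) * (lam2 + 2 * lam3 + lam4)
     + (lam1 * lam2 + lam1 * lam4 + lam2 * lam4 + 2 * lam3 * lam4 + lam4\<^sup>2) * (1 - x1 - x2))
     / (2 * x1 * lam3 * RR)"
  "Xi1_43 = (2 * x1 * (lam1 * lam2 + lam1 * lam4 + lam2 * lam4 + 2 * lam3 * lam4 + lam4\<^sup>2)
     - (lam1 - lam4) * (lam1 + lam4 + 2 * lam3) * (1 - x1 - x2)) / (2 * x1 * lam3 * RR)"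
  "Xi1_44 = lam3 * (- (lam1 - 2 * lam3 - 3 * lam4 + 2) * x1\<^sup>2
     + (lam1 - lam4 + 1) * 2 * x1 * (1 + x2)
     - (lam1 + 2 * lam3 + lam4) * (x2 - 1)\<^sup>2) / (2 * x1 * lam3 * RR)"
  unfolding Xi1_41_def Xi1_42_def Xi1_43_def Xi1_44_def
  by (simp_all add: divide_simps nonzero_divisors lam3_neq_zero two_neq_zero)
    (simp_all add: algebra_simps power2_eq_square)

lemma Xi2_row4:
  "Xi2_41 = (lam2 + lam1 + lam3) * (2 * x2 * (lam2 - lam1)
     - (lam2 + 2 * lam3 + lam4) * (1 + x2 - x1)) / (2 * x2 * lam3 * RR)"
  "Xi2_43 = (- 2 * x2 * (lam1 - lam4) * (lam1 + 2 * lam3 + lam4)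
     + (lam2 * lam1 + lam2 * lam4 + lam1 * lam4 + 2 * lam3 * lam4 + lam4\<^sup>2) * (1 - x2 - x1))
     / (2 * x2 * lam3 * RR)"
  "Xi2_42 = (2 * x2 * (lam2 * lam1 + lam2 * lam4 + lam1 * lam4 + 2 * lam3 * lam4 + lam4\<^sup>2)
     - (lam2 - lam4) * (lam2 + lam4 + 2 * lam3) * (1 - x2 - x1)) / (2 * x2 * lam3 * RR)"
  "Xi2_44 = lam3 * (- (lam2 - 2 * lam3 - 3 * lam4 + 2) * x2\<^sup>2
     + (lam2 - lam4 + 1) * 2 * x2 * (1 + x1)
     - (lam2 + 2 * lam3 + lam4) * (x1 - 1)\<^sup>2) / (2 * x2 * lam3 * RR)"
  unfolding Xi2_41_def Xi2_42_def Xi2_43_def Xi2_44_def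
  by (simp_all add: divide_simps nonzero_divisors lam3_neq_zero two_neq_zero)
    (simp_all add: algebra_simps power2_eq_square)

lemma sum_atMost_3: "(\<Sum>j\<le>(3::nat). f j) = f 0 + f 1 + f 2 + (f 3 :: 'a::comm_monoid_add)"
  by (simp add: eval_nat_numeral)

lemma cov_X1_phi_coeff:
  assumes "i < 4"
  shows "cov X1 (phi_coeff ! i) \<approx> (\<Sum>j\<le>3. Xi1 ! i ! j * phi_coeff ! j)"
  using assms
proof (cases rule: less_4_cases)
  case 1
  then show ?thesis
    using divergence_equivI(5)[OF dir1.cov_x_phi1[unfolded cov_dir]]
    by (simp add: sum_atMost_3 phi_coeff_def Xi1_def)
next
  case 2
  have "cov X1 (x1 / (s2 * LL)) \<approx>
      - (lam1 + lam3) / x1 * (x1 / (s2 * LL)) + - lam3 * (1 / (QQ * LL))"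
    by (rule divergence_equivI(3)[OF dir1.cov_x_phi2[unfolded cov_dir]]) (intro regular_intros)
  with 2 show ?thesis
    by (simp add: sum_atMost_3 phi_coeff_def Xi1_def)
next
  case 3
  have "cov X1 (x2 / (s1 * LL)) \<approx>
      - ((lam1 + lam2 + lam3) / (2 * x1)) * (1 / (s1 * s2))
      + - ((lam2 - lam4) / (2 * x1)) * (x1 / (s2 * LL))
      + - ((lam1 - lam4) / (2 * x1)) * (x2 / (s1 * LL))
      + - (lam3 * (1 - x1 - x2) / (2 * x1)) * (1 / (QQ * LL))"
    unfolding minus_divide_left
    by (rule divergence_equivI(1)[OF dir1.cov_x_phi3[unfolded cov_dir]])
      (intro regular_fields regular_intros)+
  with 3 show ?thesis
    by (simp add: sum_atMost_3 phi_coeff_def Xi1_def)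
next
  case 4
  have "cov X1 (1 / (QQ * LL)) \<approx> Xi1_41 * (1 / (s1 * s2)) + Xi1_42 * (x1 / (s2 * LL))
      + Xi1_43 * (x2 / (s1 * LL)) + Xi1_44 * (1 / (QQ * LL))"
    unfolding Xi1_row4
    by (rule divergence_equivI(1)[OF dir1.cov_x_phi4[unfolded cov_dir]])
      (intro regular_fields regular_intros)+
  with 4 show ?thesis
    by (simp add: sum_atMost_3 phi_coeff_def Xi1_def)
qed

lemma cov_X2_phi_coeff:
  assumes "i < 4"
  shows "cov X2 (phi_coeff ! i) \<approx> (\<Sum>j\<le>3. Xi2 ! i ! j * phi_coeff ! j)"
  using assms
proof (cases rule: less_4_cases)
  case 1
  then show ?thesis
    using divergence_equivI(5)[OF dir2.cov_x_phi1[unfolded cov_dir]]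
    by (simp add: sum_atMost_3 phi_coeff_def Xi2_def mult.commute)
next
  case 2
  have "cov X2 (x1 / (s2 * LL)) \<approx>
      - ((lam2 + lam1 + lam3) / (2 * x2)) * (1 / (s2 * s1))
      + - ((lam1 - lam4) / (2 * x2)) * (x2 / (s1 * LL))
      + - ((lam2 - lam4) / (2 * x2)) * (x1 / (s2 * LL))
      + - (lam3 * (1 - x2 - x1) / (2 * x2)) * (1 / (QQ * LL))"
    unfolding minus_divide_left
    by (rule divergence_equivI(2)[OF dir2.cov_x_phi3[unfolded cov_dir]])
      (intro regular_fields regular_intros)+
  with 2 show ?thesis
    by (simp add: sum_atMost_3 phi_coeff_def Xi2_def algebra_simps add_divide_distrib
        diff_divide_distrib)
next
  case 3
  have "cov X2 (x2 / (s1 * LL)) \<approx>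
      - (lam2 + lam3) / x2 * (x2 / (s1 * LL)) + - lam3 * (1 / (QQ * LL))"
    by (rule divergence_equivI(4)[OF dir2.cov_x_phi2[unfolded cov_dir]]) (intro regular_intros)
  with 3 show ?thesis
    by (simp add: sum_atMost_3 phi_coeff_def Xi2_def)
next
  case 4
  have "cov X2 (1 / (QQ * LL)) \<approx> Xi2_41 * (1 / (s2 * s1)) + Xi2_43 * (x2 / (s1 * LL))
      + Xi2_42 * (x1 / (s2 * LL)) + Xi2_44 * (1 / (QQ * LL))"
    unfolding Xi2_row4
    by (rule divergence_equivI(2)[OF dir2.cov_x_phi4[unfolded cov_dir]])
      (intro regular_fields regular_intros)+
  with 4 show ?thesis
    by (simp add: sum_atMost_3 phi_coeff_def Xi2_def ac_simps)
qed

theorem theorem4p1: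
  shows "\<forall>i<4. nabla_X_cls (cls 0 (phi ! i)) = (\<Sum>j<4. wedge_cls (Xi i j) (cls 0 (phi ! j)))"
proof (intro allI impI)
  fix i :: nat
  assume i: "i < 4"
  have "nabla_X_cls (cls 0 (phi_coeff ! i *\<^sub>f ds12))
      = (\<Sum>j\<le>3. wedge_cls (Xi i j) (cls 0 (phi_coeff ! j *\<^sub>f ds12)))"
    by (rule nabla_X_cls_eq_wedge_sum[OF Xi_def base_Xi cov_X1_phi_coeff cov_X2_phi_coeff])
      (use i in simp_all)
  moreover have "{..3} = {..<4::nat}"
    by auto
  ultimately show "nabla_X_cls (cls 0 (phi ! i)) = (\<Sum>j<4. wedge_cls (Xi i j) (cls 0 (phi ! j)))"
    using i by (simp add: phi_eq)
qed

end
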